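(* Let $f$ be a cuspidal edge in $\mathbb L^3$ (along a regular curve $\Gamma$ of type $L$) and $p\in\Sigma_f$ its singular point satisfying $i_p\ge4$. Then $i_p>4$ holds if and only if $f$ is of concave type at $p$ and $$|\kappa|=\mu_0^2$$ holds at the point $p$.
   Context: $\mathbb L^3$ is $\mathbb R^3$ with $\langle a,b\rangle_L=a_1b_1+a_2b_2-a_3b_3$; a vector $a\ne0$ is light-like if $\langle a,a\rangle_L=0$. A generalized cuspidal edge along $\Gamma$ is a $C^\infty$-map $f:\mathcal U_f=I\times(-\delta,\delta)\to\mathbb R^3$ ($I$ an open interval, $\delta>0$) with $\Gamma(s)=f(s,0)$ a regular curve, $f_t(s,0)=0$, and $f_{tt}(s,0),\Gamma'(s)$ linearly independent for all $s\in I$; $\Sigma_f=\{(s,0):s\in I\}$. A point $(s,0)$ is a cuspidal edge singular point if near it $f$ is equivalent to $(s,t)\mapsto(s,t^2,t^3)$ at the origin under local diffeomorphisms of source and target. A cuspidal edge along $\Gamma$ is such a map all of whose points $(s,0)$ are cuspidal edge singular points (with coordinates chosen so that $f_t(s,0)=0$). $\Gamma$ is of type $L$ if $\Gamma'(s)$ is light-like for all $s\in I$. $\Delta_L=\langle f_s,f_s\rangle_L\langle f_t,f_t\rangle_L-\langle f_s,f_t\rangle_L^2$; the order $i_p$ of $p=(s,0)$ is the smallest $k$ with $\partial^k\Delta_L/\partial t^k(s,0)\ne0$ ($\infty$ if none). Euclidean singular curvature: with the Euclidean inner product, let $\mathbf D^E_f(s)$ be the unit vector in the direction of the component of $f_{tt}(s,0)$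 orthogonal to $\Gamma'(s)$, and $\kappa^E_s(s)=\frac{\Gamma''(s)\cdot\mathbf D^E_f(s)}{\Gamma'(s)\cdot\Gamma'(s)}$. $f$ is of convex (resp. concave) type at $(s,0)$ if $\kappa^E_s(s)>0$ (resp. $<0$). Set-up for $\kappa$ and $\mu_0$: let $\gamma$ be the projection of $\Gamma$ to the $xy$-plane, parametrized by arc-length $s$, and (without loss of generality) $\Gamma$ future-pointing, so $\Gamma(s)=(\gamma(s),s)$ up to translation; $\kappa(s)$ is the curvature of $\gamma$ as a plane curve, $\mathbf n(s)$ its left-ward unit normal (viewed in $\mathbb R^3$ with last coordinate $0$), $\mathbf v=(0,0,1)$, and $P_s$ the plane through $\gamma(s)$ and $\Gamma(s)$ spanned by $\mathbf n(s),\mathbf v$. The section $\mathbf c_s$ of the image of $f$ by $P_s$ is a generalized cusp (a plane curve germ with vanishing first and non-vanishing second derivative), and $\mu(s,\cdot)$ is the function associated with it as follows: near $p$, after a coordinate change fixing the points $(s,0)$ and preserving $f_t(s,0)=0$, $f$ is written as $f(s,t)=\Gamma(s)+X(s,t)\mathbf n(s)+Y(s,t)\mathbf v$ with $X=A\cos\theta+B\sin\theta$, $Y=-A\sin\theta+B\cos\theta$ for a smooth function $\theta=\theta(s)$, where $A(s,t)=\int_0^tu\cos\lambda(s,u)\,du$, $B(s,t)=\int_0^tu\sin\lambda(s,u)\,du$, $\lambda(s,t)=\int_0^t\mu(s,u)\,du$ for a $C^\infty$-function $\mu$. Then $\mu_0(s):=\mu(s,0)$.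
   Formalization: Adds the assumption that p is not isolated among the singular points of order at least 4; without it the claim fails, e.g. for f(s,t) = (s, t²/2, s − st²/2 + t³/3) at the origin, where i_p = 6 but κ = 0 and f is not of concave type. *)

theory Defs
  imports "HOL-Analysis.Analysis" "HOL-Library.Extended_Nat"
begin

section \<open>Smooth maps and local diffeomorphisms\<close>

text \<open>
  These notions are used on open sets only.  On finite-dimensional spaces, asking every directional
  derivative to be of class \<open>C\<^sup>n\<close> is the usual definition of class \<open>C\<^sup>n\<^sup>+\<^sup>1\<close>.
\<close>

primrec Ck_on :: "nat \<Rightarrow> 'a::real_normed_vector set \<Rightarrow> ('a \<Rightarrow> 'b::real_normed_vector) \<Rightarrow> bool"
  where
    "Ck_on 0 S f \<longleftrightarrow> continuous_on S f"
  | "Ck_on (Suc n) S f \<longleftrightarrow>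
       (\<forall>x\<in>S. f differentiable (at x)) \<and>
       (\<forall>v. Ck_on n S (\<lambda>x. frechet_derivative f (at x) v))"

definition smooth_on :: "'a::real_normed_vector set \<Rightarrow> ('a \<Rightarrow> 'b::real_normed_vector) \<Rightarrow> bool"
  where "smooth_on S f \<longleftrightarrow> (\<forall>n. Ck_on n S f)"

definition diffeo ::
    "'a::real_normed_vector set \<Rightarrow> 'b::real_normed_vector set \<Rightarrow> ('a \<Rightarrow> 'b) \<Rightarrow> bool"
  where "diffeo U V \<phi> \<longleftrightarrow>
    open U \<and> open V \<and> bij_betw \<phi> U V \<and> smooth_on U \<phi> \<and> smooth_on V (inv_into U \<phi>)"

definition d_s :: "(real \<times> real \<Rightarrow> 'a::real_normed_vector) \<Rightarrow> real \<times> real \<Rightarrow> 'a"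
  where "d_s f = (\<lambda>(s, t). vector_derivative (\<lambda>x. f (x, t)) (at s))"

definition d_t :: "(real \<times> real \<Rightarrow> 'a::real_normed_vector) \<Rightarrow> real \<times> real \<Rightarrow> 'a"
  where "d_t f = (\<lambda>(s, t). vector_derivative (\<lambda>x. f (s, x)) (at t))"

definition velocity :: "(real \<Rightarrow> 'a::real_normed_vector) \<Rightarrow> real \<Rightarrow> 'a"
  where "velocity c = (\<lambda>s. vector_derivative c (at s))"


section \<open>Cuspidal edges\<close>

definition sing_curve :: "(real \<times> real \<Rightarrow> real ^ 3) \<Rightarrow> real \<Rightarrow> real ^ 3"
  where "sing_curve f = (\<lambda>s. f (s, 0))"

definition generalized_cuspidal_edge ::
    "real set \<Rightarrow> real \<Rightarrow> (real \<times> real \<Rightarrow> real ^ 3) \<Rightarrow> bool"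
  where "generalized_cuspidal_edge I \<delta> f \<longleftrightarrow>
    open I \<and> is_interval I \<and> I \<noteq> {} \<and> \<delta> > 0 \<and>
    smooth_on (I \<times> {-\<delta><..<\<delta>}) f \<and>
    (\<forall>s\<in>I. velocity (sing_curve f) s \<noteq> 0 \<and>
      d_t f (s, 0) = 0 \<and>
      d_t (d_t f) (s, 0) \<noteq> velocity (sing_curve f) s \<and>
      independent {d_t (d_t f) (s, 0), velocity (sing_curve f) s})"

definition standard_cuspidal_edge :: "real \<times> real \<Rightarrow> real ^ 3"
  where "standard_cuspidal_edge = (\<lambda>(s, t). vector [s, t\<^sup>2, t^3])"

definition cuspidal_edge_point ::
    "(real \<times> real) set \<Rightarrow> (real \<times> real \<Rightarrow> real ^ 3) \<Rightarrow> real \<times> real \<Rightarrow> bool"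
  where "cuspidal_edge_point D f p \<longleftrightarrow>
    (\<exists>U V \<phi> W Z \<Psi>.
      diffeo U V \<phi> \<and> (0, 0) \<in> U \<and> V \<subseteq> D \<and> \<phi> (0, 0) = p \<and>
      diffeo W Z \<Psi> \<and> standard_cuspidal_edge ` U \<subseteq> W \<and>
      (\<forall>x\<in>U. f (\<phi> x) = \<Psi> (standard_cuspidal_edge x)))"

definition cuspidal_edge :: "real set \<Rightarrow> real \<Rightarrow> (real \<times> real \<Rightarrow> real ^ 3) \<Rightarrow> bool"
  where "cuspidal_edge I \<delta> f \<longleftrightarrow>
    generalized_cuspidal_edge I \<delta> f \<and>
    (\<forall>s\<in>I. cuspidal_edge_point (I \<times> {-\<delta><..<\<delta>}) f (s, 0))"


section \<open>Lorentzian notions\<close>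

definition lorentz :: "real ^ 3 \<Rightarrow> real ^ 3 \<Rightarrow> real"
  where "lorentz a b = a $ 1 * b $ 1 + a $ 2 * b $ 2 - a $ 3 * b $ 3"

definition light_like :: "real ^ 3 \<Rightarrow> bool"
  where "light_like a \<longleftrightarrow> a \<noteq> 0 \<and> lorentz a a = 0"

definition type_L :: "real set \<Rightarrow> (real \<Rightarrow> real ^ 3) \<Rightarrow> bool"
  where "type_L I \<Gamma> \<longleftrightarrow> (\<forall>s\<in>I. light_like (velocity \<Gamma> s))"

definition Delta_L :: "(real \<times> real \<Rightarrow> real ^ 3) \<Rightarrow> real \<times> real \<Rightarrow> real"
  where "Delta_L f p =
    lorentz (d_s f p) (d_s f p) * lorentz (d_t f p) (d_t f p) - (lorentz (d_s f p) (d_t f p))\<^sup>2"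

text \<open>The infimum of the empty set in \<^typ>\<open>enat\<close> is \<open>\<infinity>\<close>.\<close>

definition sing_order :: "(real \<times> real \<Rightarrow> real ^ 3) \<Rightarrow> real \<Rightarrow> enat"
  where "sing_order f s =
    (INF k\<in>{k. (deriv ^^ k) (\<lambda>t. Delta_L f (s, t)) 0 \<noteq> 0}. enat k)"

text \<open>
  A singular point of order at least 4 can be isolated among the singular points of order at
  least 4.  The cuspidal edge \<open>f(s,t) = (s, t\<^sup>2/2, s - s t\<^sup>2/2 + t\<^sup>3/3)\<close>, along the straight
  light-like line \<open>(s,0,s)\<close>, has order 2 at \<open>(s,0)\<close> for small \<open>s \<noteq> 0\<close> and order 6 at
  \<open>(0,0)\<close>, while its singular curvature and the curvature of the projected line both vanish.
  Statements relating the order to the singular curvature therefore have to exclude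
  such isolated points.
\<close>

definition order_ge4_not_isolated :: "(real \<times> real \<Rightarrow> real ^ 3) \<Rightarrow> real \<Rightarrow> bool"
  where "order_ge4_not_isolated f s \<longleftrightarrow> (\<exists>\<^sub>F x in at s. sing_order f x \<ge> 4)"


section \<open>Euclidean singular curvature\<close>

definition D_E :: "(real \<times> real \<Rightarrow> real ^ 3) \<Rightarrow> real \<Rightarrow> real ^ 3"
  where "D_E f s =
    (let a = d_t (d_t f) (s, 0); b = velocity (sing_curve f) s
     in sgn (a - ((a \<bullet> b) / (b \<bullet> b)) *\<^sub>R b))"

definition singular_curvature_E :: "(real \<times> real \<Rightarrow> real ^ 3) \<Rightarrow> real \<Rightarrow> real"
  where "singular_curvature_E f s =
    (velocity (velocity (sing_curve f)) s \<bullet> D_E f s) /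
    (velocity (sing_curve f) s \<bullet> velocity (sing_curve f) s)"

definition concave_type :: "(real \<times> real \<Rightarrow> real ^ 3) \<Rightarrow> real \<Rightarrow> bool"
  where "concave_type f s \<longleftrightarrow> singular_curvature_E f s < 0"


section \<open>The normal form along a light-like curve\<close>

definition left_normal :: "(real \<Rightarrow> real ^ 2) \<Rightarrow> real \<Rightarrow> real ^ 2"
  where "left_normal \<gamma> s = vector [- (velocity \<gamma> s $ 2), velocity \<gamma> s $ 1]"

text \<open>Signed curvature; \<open>\<gamma>\<close> is always parametrized by arc-length below.\<close>

definition plane_curvature :: "(real \<Rightarrow> real ^ 2) \<Rightarrow> real \<Rightarrow> real"
  where "plane_curvature \<gamma> s = velocity (velocity \<gamma>) s \<bullet> left_normal \<gamma> s"

definition in_space :: "real ^ 2 \<Rightarrow> real \<Rightarrow> real ^ 3"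
  where "in_space x z = vector [x $ 1, x $ 2, z]"

text \<open>
  Interval integrals are oriented, so that \<open>t < 0\<close> is allowed.  The function \<open>\<mu>\<close> generates the
  generalized cusp \<open>t \<mapsto> (cusp_A \<mu> s t, cusp_B \<mu> s t)\<close>.
\<close>

definition cusp_angle :: "(real \<times> real \<Rightarrow> real) \<Rightarrow> real \<Rightarrow> real \<Rightarrow> real"
  where "cusp_angle \<mu> s t = (LBINT u=0..ereal t. \<mu> (s, u))"

definition cusp_A :: "(real \<times> real \<Rightarrow> real) \<Rightarrow> real \<Rightarrow> real \<Rightarrow> real"
  where "cusp_A \<mu> s t = (LBINT u=0..ereal t. u * cos (cusp_angle \<mu> s u))"

definition cusp_B :: "(real \<times> real \<Rightarrow> real) \<Rightarrow> real \<Rightarrow> real \<Rightarrow> real"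
  where "cusp_B \<mu> s t = (LBINT u=0..ereal t. u * sin (cusp_angle \<mu> s u))"

definition normal_form_map ::
    "real ^ 3 \<Rightarrow> (real \<Rightarrow> real ^ 2) \<Rightarrow> (real \<Rightarrow> real) \<Rightarrow> (real \<times> real \<Rightarrow> real) \<Rightarrow>
     real \<times> real \<Rightarrow> real ^ 3"
  where "normal_form_map c \<gamma> \<theta> \<mu> = (\<lambda>(s, t).
    (let X = cusp_A \<mu> s t * cos (\<theta> s) + cusp_B \<mu> s t * sin (\<theta> s);
         Y = - cusp_A \<mu> s t * sin (\<theta> s) + cusp_B \<mu> s t * cos (\<theta> s)
     in c + in_space (\<gamma> s) s + X *\<^sub>R in_space (left_normal \<gamma> s) 0 + Y *\<^sub>R in_space 0 1))"

text \<open>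
  The coordinate change \<open>\<phi>\<close> maps a neighbourhood of \<open>(\<sigma>\<^sub>0,0)\<close> to one of \<open>(s\<^sub>0,0)\<close>.  On the
  singular set it is allowed to be a reparametrization \<open>\<sigma> \<mapsto> s\<close>, because a curve of type \<open>L\<close>
  has the form \<open>(\<gamma>(\<sigma>), \<sigma>)\<close> with \<open>\<gamma>\<close> of unit speed, up to translation, only after passing to
  arc-length of its projection and, for a past-pointing curve, reversing its direction.  It
  fixes the points of the singular set if the curve already has this form.  The derivative of
  \<^term>\<open>f \<circ> \<phi>\<close> in the second variable vanishes on the singular set by the shape of the
  normal form.
\<close>

definition normal_form_at ::
    "real set \<Rightarrow> real \<Rightarrow> (real \<times> real \<Rightarrow> real ^ 3) \<Rightarrow> real \<Rightarrow>
     real set \<Rightarrow> real \<Rightarrow> (real \<times> real \<Rightarrow> real \<times> real) \<Rightarrow>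
     real ^ 3 \<Rightarrow> (real \<Rightarrow> real ^ 2) \<Rightarrow> (real \<Rightarrow> real) \<Rightarrow> (real \<times> real \<Rightarrow> real) \<Rightarrow> real \<Rightarrow> bool"
  where "normal_form_at I \<delta> f s0 J \<epsilon> \<phi> c \<gamma> \<theta> \<mu> \<sigma>0 \<longleftrightarrow>
    open J \<and> is_interval J \<and> \<sigma>0 \<in> J \<and> \<epsilon> > 0 \<and>
    (\<exists>V. diffeo (J \<times> {-\<epsilon><..<\<epsilon>}) V \<phi> \<and> V \<subseteq> I \<times> {-\<delta><..<\<delta>}) \<and>
    \<phi> (\<sigma>0, 0) = (s0, 0) \<and> (\<forall>\<sigma>\<in>J. snd (\<phi> (\<sigma>, 0)) = 0) \<and>
    smooth_on J \<gamma> \<and> (\<forall>\<sigma>\<in>J. norm (velocity \<gamma> \<sigma>) = 1) \<and>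
    smooth_on J \<theta> \<and> smooth_on (J \<times> {-\<epsilon><..<\<epsilon>}) \<mu> \<and>
    (\<forall>x \<in> J \<times> {-\<epsilon><..<\<epsilon>}. f (\<phi> x) = normal_form_map c \<gamma> \<theta> \<mu> x)"

end

theory Submission
  imports Defs
begin

text \<open>
  Let \<open>g = f \<circ> \<phi>\<close> be the normal form.  Since the derivative of the generalized cusp is
  \<open>t\<close> times a unit vector, \<open>g\<^sub>t = t h\<close> with
  \<open>h = cos (\<theta> - \<lambda>) n - sin (\<theta> - \<lambda>) v\<close>, where \<open>\<lambda>\<close> is the angle \<^const>\<open>cusp_angle\<close>.  The Gram
  determinant \<open>\<Delta>\<close> of \<open>f\<close> and that of \<open>g\<close> differ by the square of the Jacobian of \<open>\<phi>\<close>.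
  
  Order at least 4.  The coefficient of \<open>t\<^sup>2\<close> in \<open>\<Delta>\<close> of \<open>g\<close> is
  \<open>- sin\<^sup>2 \<theta>\<close>, so \<open>sin \<theta> = 0\<close> at every singular point of order at least 4
  (\<open>sin_zero_if_Delta_second_derivative_zero\<close>); put \<open>\<eta> = cos \<theta> = \<plusminus>1\<close> there.  Because the point
  is a limit of such points, also \<open>\<theta>' = 0\<close>, and likewise the \<open>s\<close>-derivative of
  \<open>\<Delta>\<^sub>t\<^sub>t\<close> vanishes.
  
  The fourth coefficient.  Write \<open>e\<close> for the unit tangent of \<open>\<gamma>\<close>.  By the symmetry of mixed
  partial derivatives, \<open>g\<^sub>s\<close> expands along \<open>\<sigma> = \<sigma>\<^sub>0\<close> as
  \<open>(e + v) - (t\<^sup>2/2) \<eta> \<kappa> e + o(t\<^sup>2)\<close>, whereas \<open>h = \<eta> (cos \<lambda> n + sin \<lambda> v)\<close> with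
  \<open>\<lambda> = \<mu>\<^sub>0 t + o(t)\<close>.  Substituting, \<open>\<Delta>\<close> of \<open>g\<close> is
  \<open>- (\<eta> \<kappa> + \<mu>\<^sub>0\<^sup>2) t\<^sup>4 + o(t\<^sup>4)\<close> (\<open>gram_g_limit\<close>).
  
  Comparison of orders.  The order is defined along the line \<open>s = s\<^sub>0\<close>, but the curve
  \<open>t \<mapsto> \<phi> (\<sigma>\<^sub>0, t)\<close> only touches that line, since \<open>g\<^sub>t = 0\<close> on the singular set forces the
  derivative of \<open>\<phi>\<close> in \<open>t\<close> to be vertical there.  This contact, together with the vanishing above,
  makes \<open>\<Delta>\<close> have the same leading coefficient of order 4 along both, up to a nonzero factor
  (\<open>D_\<phi>_limit\<close>).  Hence the order exceeds 4 exactly if \<open>\<eta> \<kappa> = - \<mu>\<^sub>0\<^sup>2\<close>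
  (\<open>fourth_derivative\<close>).
  
  Conclusion.  The singular curvature has the sign of \<open>\<eta> \<kappa>\<close> (\<open>concave_type_iff\<close>), and
  \<open>\<mu>\<^sub>0 \<noteq> 0\<close> at a cuspidal edge point (\<open>\<mu>_nonzero\<close>).  So \<open>\<eta> \<kappa> = - \<mu>\<^sub>0\<^sup>2\<close> says
  that \<open>\<eta> \<kappa> < 0\<close>, which is concavity, and that \<open>\<bar>\<kappa>\<bar> = \<mu>\<^sub>0\<^sup>2\<close>.
\<close>

section \<open>Calculus of smooth maps\<close>

text \<open>
  The directional derivative along a fixed vector, as an operator on functions: it can be iterated,
  and a map is of class \<open>C\<^sup>n\<^sup>+\<^sup>1\<close> if it is differentiable and all its images under these operators are
  of class \<open>C\<^sup>n\<close>.
\<close>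
definition pd :: "'a::real_normed_vector \<Rightarrow> ('a \<Rightarrow> 'b::real_normed_vector) \<Rightarrow> 'a \<Rightarrow> 'b"
  where "pd v f = (\<lambda>x. frechet_derivative f (at x) v)"

lemma Ck_on_Suc_pd:
  "Ck_on (Suc n) S f \<longleftrightarrow> (\<forall>x\<in>S. f differentiable (at x)) \<and> (\<forall>v. Ck_on n S (pd v f))"
  by (simp add: pd_def)

lemma pd_cong:
  assumes "open S" "\<And>x. x \<in> S \<Longrightarrow> f x = g x" "x \<in> S" "f differentiable (at x)"
  shows "pd v f x = pd v g x"
  unfolding pd_def
  using frechet_derivative_transform_within_open[OF assms(4,1,3) assms(2)] by simp

lemma Ck_on_cong:
  assumes "open S" "Ck_on n S f" "\<And>x. x \<in> S \<Longrightarrow> f x = g x"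
  shows "Ck_on n S g"
  using assms(2,3)
proof (induction n arbitrary: f g)
  case 0
  then show ?case using continuous_on_cong by fastforce
next
  case (Suc n)
  have "g differentiable (at x)" if "x \<in> S" for x
    using Suc.prems that assms(1)
    by (metis Ck_on_Suc_pd differentiable_def has_derivative_transform_within_open)
  moreover have "Ck_on n S (pd v g)" for v
    using Suc.IH[of "pd v f" "pd v g"] Suc.prems pd_cong[OF assms(1)]
    by (simp only: Ck_on_Suc_pd) blast
  ultimately show ?case by (simp only: Ck_on_Suc_pd) blast
qed

lemma Ck_on_Suc_imp: "Ck_on (Suc n) S f \<Longrightarrow> Ck_on n S f"
proof (induction n arbitrary: f)
  case 0
  then show ?case
    by (simp add: continuous_at_imp_continuous_on differentiable_imp_continuous_within)
next
  case (Suc n)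
  then show ?case by (metis Ck_on_Suc_pd)
qed

lemma Ck_on_const: "Ck_on n S (\<lambda>x. c)"
  by (induction n arbitrary: c) auto

lemma has_derivative_pd:
  "f differentiable (at x) \<Longrightarrow> (f has_derivative (\<lambda>v. pd v f x)) (at x)"
  unfolding pd_def by (simp add: frechet_derivative_works[symmetric])

lemma pd_eqI: "(f has_derivative f') (at x) \<Longrightarrow> pd v f x = f' v"
  unfolding pd_def using frechet_derivative_at by metis

lemma Ck_on_bounded_linear:
  assumes "open S" "bounded_linear L" "Ck_on n S f"
  shows "Ck_on n S (\<lambda>x. L (f x))"
  using assms(3)
proof (induction n arbitrary: f)
  case 0
  then show ?case
    using assms(2) bounded_linear.continuous_on by auto
next
  case (Suc n)
  have d: "((\<lambda>x. L (f x)) has_derivative (\<lambda>v. L (pd v f x))) (at x)" if "x \<in> S" for x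
    using bounded_linear.has_derivative[OF assms(2)] has_derivative_pd Suc.prems that
    by (metis Ck_on_Suc_pd)
  have "Ck_on n S (pd v (\<lambda>x. L (f x)))" for v
  proof (rule Ck_on_cong[OF assms(1), where f="\<lambda>x. L (pd v f x)"])
    show "Ck_on n S (\<lambda>x. L (pd v f x))"
      using Suc.prems by (intro Suc.IH) (simp only: Ck_on_Suc_pd)
  qed (simp add: pd_eqI[OF d])
  then show ?case using d unfolding Ck_on_Suc_pd differentiable_def by blast
qed

lemma Ck_on_add:
  assumes "open S" "Ck_on n S f" "Ck_on n S g"
  shows "Ck_on n S (\<lambda>x. f x + g x)"
  using assms(2,3)
proof (induction n arbitrary: f g)
  case 0
  then show ?case by (auto intro: continuous_on_add)
next
  case (Suc n)
  have d: "((\<lambda>x. f x + g x) has_derivative (\<lambda>v. pd v f x + pd v g x)) (at x)" if "x \<in> S" for x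
    using Suc.prems that by (intro has_derivative_add has_derivative_pd) (auto simp: Ck_on_Suc_pd)
  have "Ck_on n S (pd v (\<lambda>x. f x + g x))" for v
  proof (rule Ck_on_cong[OF assms(1), where f="\<lambda>x. pd v f x + pd v g x"])
    show "Ck_on n S (\<lambda>x. pd v f x + pd v g x)"
      using Suc.prems by (intro Suc.IH) (simp_all only: Ck_on_Suc_pd)
  qed (simp add: pd_eqI[OF d])
  then show ?case using d unfolding Ck_on_Suc_pd differentiable_def by blast
qed

lemma Ck_on_sum:
  assumes "open S" "\<And>i. i \<in> A \<Longrightarrow> Ck_on n S (f i)"
  shows "Ck_on n S (\<lambda>x. \<Sum>i\<in>A. f i x)"
  using assms(2)
  by (induction A rule: infinite_finite_induct) (auto simp: Ck_on_const intro: Ck_on_add assms)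

lemma Ck_on_bilinear:
  assumes "open S" "bounded_bilinear B" "Ck_on n S f" "Ck_on n S g"
  shows "Ck_on n S (\<lambda>x. B (f x) (g x))"
  using assms(3,4)
proof (induction n arbitrary: f g)
  case 0
  then show ?case using assms(2) by (simp add: bounded_bilinear.continuous_on)
next
  case (Suc n)
  have d: "((\<lambda>x. B (f x) (g x)) has_derivative (\<lambda>v. B (f x) (pd v g x) + B (pd v f x) (g x))) (at x)"
    if "x \<in> S" for x
    using bounded_bilinear.FDERIV[OF assms(2)] has_derivative_pd Suc.prems that
    by (metis Ck_on_Suc_pd)
  have "Ck_on n S (pd v (\<lambda>x. B (f x) (g x)))" for v
  proof (rule Ck_on_cong[OF assms(1), where f="\<lambda>x. B (f x) (pd v g x) + B (pd v f x) (g x)"])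
    have "Ck_on n S f" "Ck_on n S g" "Ck_on n S (pd v f)" "Ck_on n S (pd v g)"
      using Suc.prems by (simp_all only: Ck_on_Suc_imp, simp_all only: Ck_on_Suc_pd)
    then show "Ck_on n S (\<lambda>x. B (f x) (pd v g x) + B (pd v f x) (g x))"
      by (intro Ck_on_add assms(1) Suc.IH)
  qed (simp add: pd_eqI[OF d])
  then show ?case using d unfolding Ck_on_Suc_pd differentiable_def by blast
qed

text \<open>
  Expanding the chain rule in the basis of the middle space turns the derivative of the composite
  into a sum of products whose factors are composites again, to which the induction hypothesis
  applies.
\<close>
lemma Ck_on_compose:
  fixes \<phi> :: "'a::real_normed_vector \<Rightarrow> 'b::euclidean_space"
  assumes "open S" "Ck_on n S \<phi>" "\<And>x. x \<in> S \<Longrightarrow> \<phi> x \<in> T" "Ck_on n T f"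
  shows "Ck_on n S (\<lambda>x. f (\<phi> x))"
  using assms(2,4)
proof (induction n arbitrary: f)
  case 0
  then show ?case using assms(3)
    by (auto intro: continuous_on_compose2)
next
  case (Suc n)
  have d: "((\<lambda>x. f (\<phi> x)) has_derivative (\<lambda>v. \<Sum>b\<in>Basis. (pd v \<phi> x \<bullet> b) *\<^sub>R pd b f (\<phi> x))) (at x)"
    if "x \<in> S" for x
  proof -
    have f: "(f has_derivative (\<lambda>v. pd v f (\<phi> x))) (at (\<phi> x))"
      using Suc.prems that assms(3) by (intro has_derivative_pd) (simp only: Ck_on_Suc_pd)
    have "(\<phi> has_derivative (\<lambda>v. pd v \<phi> x)) (at x)"
      using Suc.prems that by (intro has_derivative_pd) (simp only: Ck_on_Suc_pd)
    from has_derivative_compose[OF this f]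
    have comp: "((\<lambda>x. f (\<phi> x)) has_derivative (\<lambda>v. pd (pd v \<phi> x) f (\<phi> x))) (at x)" .
    have pd: "pd w f (\<phi> x) = (\<Sum>b\<in>Basis. (w \<bullet> b) *\<^sub>R pd b f (\<phi> x))" for w
    proof -
      have L: "linear (\<lambda>v. pd v f (\<phi> x))" using f has_derivative_linear by blast
      have "pd (\<Sum>b\<in>Basis. (w \<bullet> b) *\<^sub>R b) f (\<phi> x) = (\<Sum>b\<in>Basis. (w \<bullet> b) *\<^sub>R pd b f (\<phi> x))"
        by (simp only: linear_sum[OF L] linear_scale[OF L])
      then show ?thesis by (simp only: euclidean_representation)
    qed
    show ?thesis by (rule has_derivative_eq_rhs[OF comp]) (rule ext, rule pd)
  qed
  have "Ck_on n S (pd v (\<lambda>x. f (\<phi> x)))" for v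
  proof (rule Ck_on_cong[OF assms(1), where f="\<lambda>x. \<Sum>b\<in>Basis. (pd v \<phi> x \<bullet> b) *\<^sub>R pd b f (\<phi> x)"])
    have 1: "Ck_on n S (\<lambda>x. pd b f (\<phi> x))" for b
      using Ck_on_Suc_imp[OF Suc.prems(1)] Suc.prems(2)
      by (intro Suc.IH) (simp_all only: Ck_on_Suc_pd)
    have "Ck_on n S (pd v \<phi>)" using Suc.prems(1) by (simp only: Ck_on_Suc_pd)
    then have 2: "Ck_on n S (\<lambda>x. pd v \<phi> x \<bullet> b)" for b
      by (rule Ck_on_bounded_linear[OF assms(1) bounded_linear_inner_left])
    show "Ck_on n S (\<lambda>x. \<Sum>b\<in>Basis. (pd v \<phi> x \<bullet> b) *\<^sub>R pd b f (\<phi> x))"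
      by (intro Ck_on_sum assms(1)) (rule Ck_on_bilinear[OF assms(1) bounded_bilinear_scaleR 2 1])
  qed (simp add: pd_eqI[OF d])
  then show ?case using d unfolding Ck_on_Suc_pd differentiable_def by blast
qed

lemma smooth_on_pd: "smooth_on S f \<Longrightarrow> smooth_on S (pd v f)"
  unfolding smooth_on_def using Ck_on_Suc_pd by blast

lemma smooth_on_differentiable: "smooth_on S f \<Longrightarrow> x \<in> S \<Longrightarrow> f differentiable (at x)"
  unfolding smooth_on_def using Ck_on_Suc_pd by blast

lemma smooth_on_isCont: "smooth_on S f \<Longrightarrow> x \<in> S \<Longrightarrow> isCont f x"
  using smooth_on_differentiable differentiable_imp_continuous_within by blast

lemma smooth_on_funpow_pd: "smooth_on S f \<Longrightarrow> smooth_on S ((pd v ^^ n) f)"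
  by (induction n) (auto intro: smooth_on_pd)

lemma smooth_on_cong:
  "open S \<Longrightarrow> smooth_on S f \<Longrightarrow> (\<And>x. x \<in> S \<Longrightarrow> f x = g x) \<Longrightarrow> smooth_on S g"
  unfolding smooth_on_def using Ck_on_cong by blast

lemma smooth_on_bounded_linear:
  "open S \<Longrightarrow> bounded_linear L \<Longrightarrow> smooth_on S f \<Longrightarrow> smooth_on S (\<lambda>x. L (f x))"
  unfolding smooth_on_def using Ck_on_bounded_linear by blast

lemma smooth_on_bilinear:
  "open S \<Longrightarrow> bounded_bilinear B \<Longrightarrow> smooth_on S f \<Longrightarrow> smooth_on S g \<Longrightarrow> smooth_on S (\<lambda>x. B (f x) (g x))"
  unfolding smooth_on_def using Ck_on_bilinear by blast

lemma smooth_on_add: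
  "open S \<Longrightarrow> smooth_on S f \<Longrightarrow> smooth_on S g \<Longrightarrow> smooth_on S (\<lambda>x. f x + g x)"
  unfolding smooth_on_def using Ck_on_add by blast

lemma smooth_on_compose:
  fixes \<phi> :: "'a::real_normed_vector \<Rightarrow> 'b::euclidean_space"
  shows "open S \<Longrightarrow> smooth_on S \<phi> \<Longrightarrow> (\<And>x. x \<in> S \<Longrightarrow> \<phi> x \<in> T) \<Longrightarrow> smooth_on T f
    \<Longrightarrow> smooth_on S (\<lambda>x. f (\<phi> x))"
  unfolding smooth_on_def using Ck_on_compose by blast

section \<open>Partial derivatives and Taylor expansion in the plane\<close>
abbreviation ps :: "(real \<times> real \<Rightarrow> 'b::real_normed_vector) \<Rightarrow> real \<times> real \<Rightarrow> 'b"
  where "ps \<equiv> pd (1, 0)"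
abbreviation pt :: "(real \<times> real \<Rightarrow> 'b::real_normed_vector) \<Rightarrow> real \<times> real \<Rightarrow> 'b"
  where "pt \<equiv> pd (0, 1)"

lemma has_vector_derivative_ps:
  assumes "f differentiable (at (s, t))"
  shows "((\<lambda>x. f (x, t)) has_vector_derivative ps f (s, t)) (at s)"
proof -
  have "((\<lambda>x. (x, t)) has_derivative (\<lambda>v. (v, 0))) (at s)"
    by (auto intro!: derivative_eq_intros)
  from has_derivative_compose[OF this has_derivative_pd[OF assms]]
  have comp: "((\<lambda>x. f (x, t)) has_derivative (\<lambda>v. pd (v, 0) f (s, t))) (at s)" .
  have lin: "pd (v, 0) f (s, t) = v *\<^sub>R ps f (s, t)" for v
    using linear_scale[OF has_derivative_linear[OF has_derivative_pd[OF assms]], of v "(1, 0)"]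
    by simp
  show ?thesis unfolding has_vector_derivative_def
    by (rule has_derivative_eq_rhs[OF comp]) (rule ext, rule lin)
qed

lemma has_vector_derivative_pt:
  assumes "f differentiable (at (s, t))"
  shows "((\<lambda>x. f (s, x)) has_vector_derivative pt f (s, t)) (at t)"
proof -
  have "((\<lambda>x. (s, x)) has_derivative (\<lambda>v. (0, v))) (at t)"
    by (auto intro!: derivative_eq_intros)
  from has_derivative_compose[OF this has_derivative_pd[OF assms]]
  have comp: "((\<lambda>x. f (s, x)) has_derivative (\<lambda>v. pd (0, v) f (s, t))) (at t)" .
  have lin: "pd (0, v) f (s, t) = v *\<^sub>R pt f (s, t)" for v
    using linear_scale[OF has_derivative_linear[OF has_derivative_pd[OF assms]], of v "(0, 1)"]
    by simp
  show ?thesis unfolding has_vector_derivative_def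
    by (rule has_derivative_eq_rhs[OF comp]) (rule ext, rule lin)
qed

lemma pd_pair:
  fixes f :: "real \<times> real \<Rightarrow> 'b::real_normed_vector"
  assumes "f differentiable (at x)"
  shows "pd v f x = fst v *\<^sub>R ps f x + snd v *\<^sub>R pt f x"
proof -
  have L: "linear (\<lambda>v. pd v f x)" using has_derivative_linear[OF has_derivative_pd[OF assms]] .
  have "pd (fst v *\<^sub>R (1, 0) + snd v *\<^sub>R (0, 1)) f x = fst v *\<^sub>R ps f x + snd v *\<^sub>R pt f x"
    by (simp only: linear_add[OF L] linear_scale[OF L])
  then show ?thesis by (cases v) simp
qed

lemma d_s_eq_ps: "f differentiable (at p) \<Longrightarrow> d_s f p = ps f p"
  by (cases p) (simp add: d_s_def vector_derivative_at has_vector_derivative_ps)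

lemma d_t_eq_pt: "f differentiable (at p) \<Longrightarrow> d_t f p = pt f p"
  by (cases p) (simp add: d_t_def vector_derivative_at has_vector_derivative_pt)

lemma rect_near:
  fixes s t :: real
  assumes "open S" "(s, t) \<in> S"
  shows "\<exists>h>0. \<forall>x y. \<bar>x - s\<bar> \<le> h \<and> \<bar>y - t\<bar> \<le> h \<longrightarrow> (x, y) \<in> S"
proof -
  obtain e where e: "e > 0" "ball (s, t) e \<subseteq> S" using assms open_contains_ball by blast
  show ?thesis
  proof (intro exI[of _ "e/3"] conjI allI impI)
    show "e/3 > 0" using e by simp
    fix x y assume "\<bar>x - s\<bar> \<le> e/3 \<and> \<bar>y - t\<bar> \<le> e/3"
    then have "dist (s, t) (x, y) < e"
      using norm_Pair_le[of "s - x" "t - y"] \<open>e > 0\<close>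
      by (auto simp: dist_norm abs_minus_commute)
    then show "(x, y) \<in> S" using e by auto
  qed
qed

text \<open>
  Applying the mean value theorem twice to the mixed second difference over a square of side
  \<open>h\<close>, in either order of the variables, gives \<open>h\<^sup>2\<close> times either mixed derivative at some point
  of the square.  Both are continuous, so the claim follows as \<open>h\<close> tends to 0.
\<close>
lemma ps_pt_commute_real:
  fixes f :: "real \<times> real \<Rightarrow> real"
  assumes S: "open S" and f: "smooth_on S f" and p: "(s, t) \<in> S"
  shows "ps (pt f) (s, t) = pt (ps f) (s, t)"
proof -
  obtain h0 where h0: "h0 > 0" "\<And>x y. \<bar>x - s\<bar> \<le> h0 \<Longrightarrow> \<bar>y - t\<bar> \<le> h0 \<Longrightarrow> (x, y) \<in> S"
    using rect_near[OF S p] by blast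
  have ds: "((\<lambda>x. g (x, b)) has_real_derivative ps g (a, b)) (at a)"
    and dt: "((\<lambda>x. g (a, x)) has_real_derivative pt g (a, b)) (at b)"
    if "smooth_on S g" "\<bar>a - s\<bar> \<le> h0" "\<bar>b - t\<bar> \<le> h0" for g :: "real \<times> real \<Rightarrow> real" and a b
    using has_vector_derivative_ps has_vector_derivative_pt smooth_on_differentiable that h0(2)
    by (metis has_real_derivative_iff_has_vector_derivative)+
  have ex: "\<exists>p q. \<bar>fst p - s\<bar> \<le> h \<and> \<bar>snd p - t\<bar> \<le> h \<and> \<bar>fst q - s\<bar> \<le> h \<and> \<bar>snd q - t\<bar> \<le> h
      \<and> ps (pt f) q = pt (ps f) p" if h: "0 < h" "h \<le> h0" for h
  proof -
    let ?F = "f (s+h,t+h) - f (s+h,t) - f (s,t+h) + f (s,t)"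
    have near: "\<bar>x - s\<bar> \<le> h0" if "s \<le> x" "x \<le> s + h" for x using that h by auto
    have near': "\<bar>x - t\<bar> \<le> h0" if "t \<le> x" "x \<le> t + h" for x using that h by auto
    have h': "s \<le> s + h" "t \<le> t + h" "s \<le> s" "t \<le> t" "s + h \<le> s + h" "t + h \<le> t + h"
      "s < s + h" "t < t + h" using h by auto
    have "((\<lambda>x. f (x,t+h) - f (x,t)) has_real_derivative ps f (x,t+h) - ps f (x,t)) (at x)"
      if "s \<le> x" "x \<le> s + h" for x
      by (intro DERIV_diff ds[OF f] near near' that h')
    from MVT2[OF h'(7) this] obtain \<xi> where \<xi>: "s < \<xi>" "\<xi> < s + h"
      "f (s+h,t+h) - f (s+h,t) - (f (s,t+h) - f (s,t)) = (s + h - s) * (ps f (\<xi>,t+h) - ps f (\<xi>,t))"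
      by blast
    have "((\<lambda>y. ps f (\<xi>,y)) has_real_derivative pt (ps f) (\<xi>,y)) (at y)"
      if "t \<le> y" "y \<le> t + h" for y
      using \<xi>(1,2) by (intro dt[OF smooth_on_pd[OF f]] near near' that h') auto
    from MVT2[OF h'(8) this] obtain \<eta> where \<eta>: "t < \<eta>" "\<eta> < t + h"
      "ps f (\<xi>,t+h) - ps f (\<xi>,t) = (t + h - t) * pt (ps f) (\<xi>,\<eta>)"
      by blast
    have "((\<lambda>y. f (s+h,y) - f (s,y)) has_real_derivative pt f (s+h,y) - pt f (s,y)) (at y)"
      if "t \<le> y" "y \<le> t + h" for y
      by (intro DERIV_diff dt[OF f] near near' that h')
    from MVT2[OF h'(8) this] obtain \<eta>' where \<eta>': "t < \<eta>'" "\<eta>' < t + h"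
      "f (s+h,t+h) - f (s,t+h) - (f (s+h,t) - f (s,t)) = (t + h - t) * (pt f (s+h,\<eta>') - pt f (s,\<eta>'))"
      by blast
    have "((\<lambda>x. pt f (x,\<eta>')) has_real_derivative ps (pt f) (x,\<eta>')) (at x)"
      if "s \<le> x" "x \<le> s + h" for x
      using \<eta>'(1,2) by (intro ds[OF smooth_on_pd[OF f]] near near' that h') auto
    from MVT2[OF h'(7) this] obtain \<xi>' where \<xi>': "s < \<xi>'" "\<xi>' < s + h"
      "pt f (s+h,\<eta>') - pt f (s,\<eta>') = (s + h - s) * ps (pt f) (\<xi>',\<eta>')"
      by blast
    have "?F = h * (h * pt (ps f) (\<xi>,\<eta>))" using \<xi> \<eta> by simp
    moreover have "?F = h * (h * ps (pt f) (\<xi>',\<eta>'))" using \<xi>' \<eta>' by simp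
    ultimately have "ps (pt f) (\<xi>',\<eta>') = pt (ps f) (\<xi>,\<eta>)" using h by simp
    then show ?thesis using \<xi> \<eta> \<xi>' \<eta>'
      by (intro exI[of _ "(\<xi>,\<eta>)"] exI[of _ "(\<xi>',\<eta>')"]) auto
  qed
  define hn where "hn n = h0 / real (Suc n)" for n
  have hn: "0 < hn n" "hn n \<le> h0" for n using h0(1) by (auto simp: hn_def field_simps)
  have hn0: "hn \<longlonglongrightarrow> 0" unfolding hn_def by (rule LIMSEQ_Suc[OF lim_const_over_n])
  obtain P Q where PQ: "\<And>n. \<bar>fst (P n) - s\<bar> \<le> hn n \<and> \<bar>snd (P n) - t\<bar> \<le> hn n \<and>
      \<bar>fst (Q n) - s\<bar> \<le> hn n \<and> \<bar>snd (Q n) - t\<bar> \<le> hn n \<and> ps (pt f) (Q n) = pt (ps f) (P n)"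
    using ex[OF hn] by metis
  have lim: "X \<longlonglongrightarrow> (s, t)" if "\<And>n. \<bar>fst (X n) - s\<bar> \<le> hn n \<and> \<bar>snd (X n) - t\<bar> \<le> hn n"
    for X :: "nat \<Rightarrow> real \<times> real"
  proof -
    have "(\<lambda>n. fst (X n) - s) \<longlonglongrightarrow> 0" "(\<lambda>n. snd (X n) - t) \<longlonglongrightarrow> 0"
      using that by (auto intro!: Lim_null_comparison[OF _ hn0])
    then have "(\<lambda>n. (fst (X n), snd (X n))) \<longlonglongrightarrow> (s, t)"
      by (intro tendsto_Pair) (simp_all add: LIM_zero_iff)
    then show ?thesis by simp
  qed
  have "(\<lambda>n. ps (pt f) (Q n)) \<longlonglongrightarrow> ps (pt f) (s, t)"
    using lim[of Q] PQ smooth_on_isCont[OF smooth_on_pd[OF smooth_on_pd[OF f]] p]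
    by (blast intro: isCont_tendsto_compose)
  moreover have "(\<lambda>n. pt (ps f) (P n)) \<longlonglongrightarrow> pt (ps f) (s, t)"
    using lim[of P] PQ smooth_on_isCont[OF smooth_on_pd[OF smooth_on_pd[OF f]] p]
    by (blast intro: isCont_tendsto_compose)
  moreover have "(\<lambda>n. ps (pt f) (Q n)) = (\<lambda>n. pt (ps f) (P n))" using PQ by blast
  ultimately show ?thesis by (metis LIMSEQ_unique)
qed

lemma pd_bounded_linear:
  "bounded_linear L \<Longrightarrow> f differentiable (at x) \<Longrightarrow> pd v (\<lambda>x. L (f x)) x = L (pd v f x)"
  by (rule pd_eqI) (rule bounded_linear.has_derivative[OF _ has_derivative_pd])

lemma ps_pt_commute:
  fixes f :: "real \<times> real \<Rightarrow> 'b::real_inner"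
  assumes S: "open S" and f: "smooth_on S f" and p: "(s, t) \<in> S"
  shows "ps (pt f) (s, t) = pt (ps f) (s, t)"
proof -
  have "ps (pt f) (s, t) \<bullet> c = pt (ps f) (s, t) \<bullet> c" for c
  proof -
    have L: "bounded_linear (\<lambda>x. x \<bullet> c)" by (rule bounded_linear_inner_left)
    note d = smooth_on_differentiable
    have 1: "smooth_on S (\<lambda>x. f x \<bullet> c)" by (rule smooth_on_bounded_linear[OF S L f])
    have e: "pd v (\<lambda>x. g x \<bullet> c) x = pd v g x \<bullet> c" if "x \<in> S" "smooth_on S g"
      for x v and g :: "real \<times> real \<Rightarrow> 'b"
      using pd_bounded_linear[OF L d] that by blast
    have "pd w (pd v (\<lambda>x. f x \<bullet> c)) (s, t) = pd w (pd v f) (s, t) \<bullet> c" for v w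
      using pd_cong[OF S e[OF _ f] p d[OF smooth_on_pd[OF 1] p], of w v]
        e[OF p smooth_on_pd[OF f]] by simp
    then show ?thesis using ps_pt_commute_real[OF S 1 p] by simp
  qed
  then show ?thesis by (metis vector_eq_rdot)
qed

lemma has_real_derivative_pt:
  fixes f :: "real \<times> real \<Rightarrow> real"
  shows "f differentiable (at (s, t)) \<Longrightarrow> ((\<lambda>x. f (s, x)) has_real_derivative pt f (s, t)) (at t)"
  using has_vector_derivative_pt by (metis has_real_derivative_iff_has_vector_derivative)

text \<open>
  Links the order of a singular point, which is defined by iterated \<^const>\<open>deriv\<close> on a
  vertical line, with partial derivatives, which are continuous in both variables.
\<close>
lemma deriv_funpow_eq_pt:
  fixes D :: "real \<times> real \<Rightarrow> real"
  assumes D: "smooth_on S D" "open S" "(s, t) \<in> S"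
  shows "(deriv ^^ k) (\<lambda>t. D (s, t)) t = (pt ^^ k) D (s, t)"
  using assms(3)
proof (induction k arbitrary: t)
  case 0
  then show ?case by simp
next
  case (Suc k)
  have "open ((\<lambda>x. (s, x)) -` S)"
    by (rule open_vimage[OF D(2)]) (intro continuous_intros)
  then have "eventually (\<lambda>x. (s, x) \<in> S) (nhds t)"
    using eventually_nhds_in_open[of "(\<lambda>x. (s, x)) -` S" t] Suc.prems by simp
  then have "eventually (\<lambda>x. (deriv ^^ k) (\<lambda>t. D (s, t)) x = (pt ^^ k) D (s, x)) (nhds t)"
    by (rule eventually_mono) (rule Suc.IH)
  then have "deriv ((deriv ^^ k) (\<lambda>t. D (s, t))) t = deriv (\<lambda>x. (pt ^^ k) D (s, x)) t"
    by (rule deriv_cong_ev) simp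
  also have "\<dots> = pt ((pt ^^ k) D) (s, t)"
    by (intro DERIV_imp_deriv has_real_derivative_pt
      smooth_on_differentiable[OF smooth_on_funpow_pd[OF D(1)] Suc.prems])
  finally show ?case by simp
qed

text \<open>
  Taylor expansion in the second variable with the base point \<open>s x\<close> moving as well.  The moving
  base point is what makes the expansion usable along the curves \<open>t \<mapsto> \<phi> (\<sigma>, t)\<close>; the
  remainder converges since the partial derivative of order \<open>n\<close> is jointly continuous.
\<close>
lemma taylor_along:
  fixes D :: "real \<times> real \<Rightarrow> real"
  assumes D: "smooth_on S D" "open S" "(s0, 0) \<in> S"
    and s: "(s \<longlongrightarrow> s0) F" and b: "(b \<longlongrightarrow> 0) F" "\<forall>\<^sub>F x in F. b x \<noteq> 0"
  shows "((\<lambda>x. (D (s x, b x) - (\<Sum>m<n. (pt ^^ m) D (s x, 0) / fact m * b x ^ m)) / b x ^ n)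
     \<longlongrightarrow> (pt ^^ n) D (s0, 0) / fact n) F"
proof -
  obtain h where h: "h > 0" "\<And>x y. \<bar>x - s0\<bar> \<le> h \<Longrightarrow> \<bar>y\<bar> \<le> h \<Longrightarrow> (x, y) \<in> S"
    using rect_near[OF D(2,3)] by auto
  have ex: "\<exists>\<xi>. \<bar>\<xi>\<bar> \<le> \<bar>y\<bar> \<and>
     D (x, y) = (\<Sum>m<n. (pt ^^ m) D (x, 0) / fact m * y ^ m) + (pt ^^ n) D (x, \<xi>) / fact n * y ^ n"
    if "\<bar>x - s0\<bar> \<le> h" "\<bar>y\<bar> \<le> h" for x y
  proof (rule Maclaurin_bi_le[where diff="\<lambda>m t. (pt ^^ m) D (x, t)"])
    show "\<forall>m t. m < n \<and> \<bar>t\<bar> \<le> \<bar>y\<bar> \<longrightarrow>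
      ((\<lambda>t. (pt ^^ m) D (x, t)) has_real_derivative (pt ^^ Suc m) D (x, t)) (at t)"
    proof (intro allI impI)
      fix m t assume "m < n \<and> \<bar>t\<bar> \<le> \<bar>y\<bar>"
      then have "(x, t) \<in> S" using that h by simp
      then show "((\<lambda>t. (pt ^^ m) D (x, t)) has_real_derivative (pt ^^ Suc m) D (x, t)) (at t)"
        unfolding funpow.simps o_apply
        by (intro has_real_derivative_pt smooth_on_differentiable[OF smooth_on_funpow_pd[OF D(1)]])
    qed
  qed simp
  \<comment> \<open>the intermediate point of the Lagrange remainder at \<open>(x, y)\<close>\<close>
  define \<xi> where "\<xi> x y = (SOME \<xi>. \<bar>\<xi>\<bar> \<le> \<bar>y\<bar> \<and>
     D (x, y) = (\<Sum>m<n. (pt ^^ m) D (x, 0) / fact m * y ^ m) + (pt ^^ n) D (x, \<xi>) / fact n * y ^ n)"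
    for x y
  have \<xi>: "\<bar>\<xi> x y\<bar> \<le> \<bar>y\<bar> \<and>
     D (x, y) = (\<Sum>m<n. (pt ^^ m) D (x, 0) / fact m * y ^ m) + (pt ^^ n) D (x, \<xi> x y) / fact n * y ^ n"
    if "\<bar>x - s0\<bar> \<le> h" "\<bar>y\<bar> \<le> h" for x y
    unfolding \<xi>_def by (rule someI_ex[OF ex[OF that]])
  have "\<forall>\<^sub>F x in F. \<bar>s x - s0\<bar> < h" "\<forall>\<^sub>F x in F. \<bar>b x - 0\<bar> < h"
    using s b(1) h(1) unfolding tendsto_iff dist_real_def by blast+
  then have ev: "\<forall>\<^sub>F x in F. \<bar>s x - s0\<bar> \<le> h \<and> \<bar>b x\<bar> \<le> h \<and> b x \<noteq> 0"
    using b(2) by eventually_elim auto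
  have "((\<lambda>x. \<xi> (s x) (b x)) \<longlongrightarrow> 0) F"
    by (rule Lim_null_comparison[OF _ tendsto_rabs_zero[OF b(1)]])
      (use ev in eventually_elim, use \<xi> in auto)
  with s have "((\<lambda>x. (s x, \<xi> (s x) (b x))) \<longlongrightarrow> (s0, 0)) F" by (rule tendsto_Pair)
  then have "((\<lambda>x. (pt ^^ n) D (s x, \<xi> (s x) (b x)) / fact n) \<longlongrightarrow> (pt ^^ n) D (s0, 0) / fact n) F"
    by (intro tendsto_divide tendsto_const
      isCont_tendsto_compose[OF smooth_on_isCont[OF smooth_on_funpow_pd[OF D(1)] D(3)]]) auto
  then show ?thesis
  proof (rule Lim_transform_eventually)
    show "\<forall>\<^sub>F x in F. (pt ^^ n) D (s x, \<xi> (s x) (b x)) / fact n =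
      (D (s x, b x) - (\<Sum>m<n. (pt ^^ m) D (s x, 0) / fact m * b x ^ m)) / b x ^ n"
      using ev
    proof eventually_elim
      case (elim x)
      then show ?case using \<xi>[of "s x" "b x"] by (simp add: field_simps)
    qed
  qed
qed

section \<open>Two facts from real analysis\<close>
lemma derivative_zero_if_zeros_accumulate:
  fixes F :: "real \<Rightarrow> real"
  assumes d: "(F has_real_derivative D) (at a)" and "F a = 0" and fr: "\<exists>\<^sub>F x in at a. F x = 0"
  shows "D = 0"
proof (rule ccontr)
  assume "D \<noteq> 0"
  have "((\<lambda>x. (F x - F a) / (x - a)) \<longlongrightarrow> D) (at a)"
    using d by (simp add: has_field_derivative_iff)
  then have "\<forall>\<^sub>F x in at a. (F x - F a) / (x - a) \<noteq> 0"
    using \<open>D \<noteq> 0\<close> by (rule tendsto_imp_eventually_ne)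
  then have "\<forall>\<^sub>F x in at a. F x \<noteq> 0"
    by (rule eventually_mono) (use \<open>F a = 0\<close> in auto)
  with fr show False by (simp add: frequently_def)
qed

text \<open>
  By l'Hopital's rule.  This expands a curve whose velocity is \<open>t\<close> times a vector, that is, a
  generalized cusp; the third-order coefficient is what distinguishes an ordinary cusp.
\<close>
lemma cusp_third_order:
  fixes k m :: "real \<Rightarrow> real"
  assumes k: "\<forall>\<^sub>F t in nhds 0. (k has_real_derivative t * m t) (at t)"
    and m: "(m has_real_derivative m') (at 0)"
  shows "((\<lambda>t. (k t - k 0 - m 0 * t^2 / 2) / t^3) \<longlongrightarrow> m' / 3) (at 0)"
proof (rule lhopital[where f' = "\<lambda>t. t * (m t - m 0)" and g' = "\<lambda>t. 3 * t^2"])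
  have "(k has_real_derivative 0 * m 0) (at 0)" using eventually_nhds_x_imp_x[OF k] .
  then have "(k \<longlongrightarrow> k 0) (at 0)" using DERIV_isCont isContD by blast
  then have "((\<lambda>t. k t - k 0 - m 0 * t^2 / 2) \<longlongrightarrow> k 0 - k 0 - m 0 * 0^2 / 2) (at 0)"
    by (intro tendsto_intros) simp_all
  then show "((\<lambda>t. k t - k 0 - m 0 * t^2 / 2) \<longlongrightarrow> 0) (at 0)" by simp
  have "((\<lambda>t::real. t^3) \<longlongrightarrow> 0^3) (at 0)" by (intro tendsto_intros)
  then show "((\<lambda>t::real. t^3) \<longlongrightarrow> 0) (at 0)" by simp
  show "\<forall>\<^sub>F x in at (0::real). x^3 \<noteq> 0" "\<forall>\<^sub>F x in at (0::real). 3 * x^2 \<noteq> 0"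
    by (auto simp: eventually_at_filter)
  show "\<forall>\<^sub>F t in at 0. ((\<lambda>t. k t - k 0 - m 0 * t^2 / 2) has_real_derivative t * (m t - m 0)) (at t)"
    using eventually_nhds_conv_at[THEN iffD1, OF k, THEN conjunct1]
    by (rule eventually_mono) (auto intro!: derivative_eq_intros simp: algebra_simps)
  show "\<forall>\<^sub>F t in at 0. ((\<lambda>t. t^3) has_real_derivative 3 * t^2) (at t)" for t :: real
    by (auto intro!: derivative_eq_intros always_eventually)
  have "((\<lambda>t. (m t - m 0) / (t - 0) / 3) \<longlongrightarrow> m' / 3) (at 0)"
    using m unfolding has_field_derivative_iff by (intro tendsto_intros) auto
  then show "((\<lambda>t. t * (m t - m 0) / (3 * t^2)) \<longlongrightarrow> m' / 3) (at 0)"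
    by (rule Lim_transform_eventually) (auto simp: eventually_at_filter power2_eq_square)
qed

section \<open>The Lorentzian Gram determinant\<close>
lemma lorentz_scaleR [simp]:
  "lorentz (r *\<^sub>R a) b = r * lorentz a b" "lorentz a (r *\<^sub>R b) = r * lorentz a b"
  by (simp_all add: lorentz_def algebra_simps)

lemma lorentz_add:
  "lorentz (a + b) c = lorentz a c + lorentz b c" "lorentz c (a + b) = lorentz c a + lorentz c b"
  by (simp_all add: lorentz_def algebra_simps)

lemma lorentz_commute: "lorentz a b = lorentz b a"
  by (simp add: lorentz_def)

lemma tendsto_lorentz [tendsto_intros]:
  "(f \<longlongrightarrow> a) F \<Longrightarrow> (g \<longlongrightarrow> b) F \<Longrightarrow> ((\<lambda>x. lorentz (f x) (g x)) \<longlongrightarrow> lorentz a b) F"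
  unfolding lorentz_def by (intro tendsto_intros)

lemma smooth_on_lorentz:
  assumes "open S" "smooth_on S f" "smooth_on S g"
  shows "smooth_on S (\<lambda>x. lorentz (f x) (g x))"
proof -
  have n: "smooth_on S (\<lambda>x. h x $ i)" if "smooth_on S h" for i and h :: "'a \<Rightarrow> real^3"
    by (rule smooth_on_bounded_linear[OF assms(1) bounded_linear_vec_nth that])
  have m: "smooth_on S (\<lambda>x. p x * q x)" if "smooth_on S p" "smooth_on S q" for p q :: "'a \<Rightarrow> real"
    by (rule smooth_on_bilinear[OF assms(1) bounded_bilinear_mult that])
  have eq: "lorentz a b = a $ 1 * b $ 1 + a $ 2 * b $ 2 + - (a $ 3 * b $ 3)" for a b
    by (simp add: lorentz_def)
  show ?thesis unfolding eq
    by (rule smooth_on_add[OF assms(1) smooth_on_add[OF assms(1)]])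
      (rule m n assms smooth_on_bounded_linear[OF assms(1) bounded_linear_minus[OF bounded_linear_ident]])+
qed

definition lorentz_gram :: "real ^ 3 \<Rightarrow> real ^ 3 \<Rightarrow> real"
  where "lorentz_gram a b = lorentz a a * lorentz b b - (lorentz a b)\<^sup>2"

lemma lorentz_gram_combination:
  "lorentz_gram (p *\<^sub>R a + q *\<^sub>R b) (r *\<^sub>R a + u *\<^sub>R b) = (p * u - q * r)\<^sup>2 * lorentz_gram a b"
  by (simp add: lorentz_gram_def lorentz_add lorentz_commute[of b a] power2_eq_square algebra_simps)

lemma lorentz_gram_scaleR: "lorentz_gram a (r *\<^sub>R b) = r\<^sup>2 * lorentz_gram a b"
  by (simp add: lorentz_gram_def power2_eq_square algebra_simps)

lemma smooth_on_lorentz_gram: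
  assumes "open S" "smooth_on S f" "smooth_on S g"
  shows "smooth_on S (\<lambda>x. lorentz_gram (f x) (g x))"
proof -
  have m: "smooth_on S (\<lambda>x. p x * q x)" if "smooth_on S p" "smooth_on S q" for p q :: "'a \<Rightarrow> real"
    by (rule smooth_on_bilinear[OF assms(1) bounded_bilinear_mult that])
  have eq: "lorentz_gram a b = lorentz a a * lorentz b b + - (lorentz a b * lorentz a b)" for a b
    by (simp add: lorentz_gram_def power2_eq_square)
  show ?thesis unfolding eq
    by (rule smooth_on_add[OF assms(1)])
      (rule m smooth_on_lorentz assms smooth_on_bounded_linear[OF assms(1) bounded_linear_minus[OF bounded_linear_ident]])+
qed

lemma tendsto_lorentz_gram [tendsto_intros]:
  "(f \<longlongrightarrow> a) F \<Longrightarrow> (g \<longlongrightarrow> b) F \<Longrightarrow> ((\<lambda>x. lorentz_gram (f x) (g x)) \<longlongrightarrow> lorentz_gram a b) F"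
  unfolding lorentz_gram_def by (intro tendsto_intros)

section \<open>Derivatives of the normal form\<close>
lemma interval_integral_has_derivative:
  fixes f :: "real \<Rightarrow> real"
  assumes f: "continuous_on {-e<..<e} f" and t: "\<bar>t\<bar> < e"
  shows "((\<lambda>x. LBINT u=0..ereal x. f u) has_real_derivative f t) (at t)"
proof -
  define r where "r = (\<bar>t\<bar> + e) / 2"
  have r: "\<bar>t\<bar> < r" "r < e" using t by (auto simp: r_def)
  have "((\<lambda>x. LBINT u=ereal 0..ereal x. f u) has_vector_derivative f t) (at t within {-r..r})"
    by (rule interval_integral_FTC2) (use r in \<open>auto intro!: continuous_on_subset[OF f]\<close>)
  moreover have "at t within {-r..r} = at t"
    by (rule at_within_interior) (use r in auto)
  ultimately show ?thesis
    by (simp add: has_real_derivative_iff_has_vector_derivative zero_ereal_def)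
qed

lemma in_space_nth [simp]: "in_space x z $ 1 = x $ 1" "in_space x z $ 2 = x $ 2" "in_space x z $ 3 = z"
  by (simp_all add: in_space_def vector_3)

lemma in_space_lin: "in_space x z + in_space y w = in_space (x + y) (z + w)"
  "r *\<^sub>R in_space x z = in_space (r *\<^sub>R x) (r * z)"
  by (simp_all add: vec_eq_iff forall_3)

lemma left_normal_nth [simp]: "left_normal \<gamma> s $ 1 = - (velocity \<gamma> s $ 2)" "left_normal \<gamma> s $ 2 = velocity \<gamma> s $ 1"
  by (simp_all add: left_normal_def vector_2)

lemma velocity_eq_pd: "c differentiable (at s) \<Longrightarrow> velocity c s = pd 1 c s"
  by (simp add: velocity_def pd_def frechet_derivative_eq_vector_derivative)

lemma smooth_on_velocity: "open S \<Longrightarrow> smooth_on S c \<Longrightarrow> smooth_on S (velocity c)"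
  by (rule smooth_on_cong[OF _ smooth_on_pd[of S c 1]])
    (auto simp: velocity_eq_pd smooth_on_differentiable)

lemma smooth_on_has_velocity:
  "smooth_on S c \<Longrightarrow> s \<in> S \<Longrightarrow> (c has_vector_derivative velocity c s) (at s)"
  unfolding velocity_def using smooth_on_differentiable vector_derivative_works by blast

text \<open>
  The derivative of the normal form in \<open>t\<close>, divided by \<open>t\<close>.
\<close>
definition cusp_direction ::
    "(real \<Rightarrow> real ^ 2) \<Rightarrow> (real \<Rightarrow> real) \<Rightarrow> (real \<times> real \<Rightarrow> real) \<Rightarrow> real \<times> real \<Rightarrow> real ^ 3"
  where "cusp_direction \<gamma> \<theta> \<mu> = (\<lambda>(s, t).
    in_space (cos (\<theta> s - cusp_angle \<mu> s t) *\<^sub>R left_normal \<gamma> s) (- sin (\<theta> s - cusp_angle \<mu> s t)))"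

lemma cusp_angle_0 [simp]: "cusp_angle \<mu> s 0 = 0"
  by (simp add: cusp_angle_def zero_ereal_def[symmetric])

lemma cusp_angle_deriv:
  assumes \<mu>: "smooth_on (J \<times> {-\<epsilon><..<\<epsilon>}) \<mu>" and s: "s \<in> J" "\<bar>t\<bar> < \<epsilon>"
  shows "(cusp_angle \<mu> s has_real_derivative \<mu> (s, t)) (at t)"
proof -
  have "continuous_on {-\<epsilon><..<\<epsilon>} (\<lambda>u. \<mu> (s, u))"
  proof (rule continuous_on_compose2[where f = "\<lambda>u. (s, u)" and t = "J \<times> {-\<epsilon><..<\<epsilon>}"])
    show "continuous_on (J \<times> {-\<epsilon><..<\<epsilon>}) \<mu>" using \<mu> Ck_on.simps(1) unfolding smooth_on_def by blast
    show "continuous_on {-\<epsilon><..<\<epsilon>} (\<lambda>u. (s, u))" by (intro continuous_intros)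
  qed (use s(1) in auto)
  from interval_integral_has_derivative[OF this s(2)] show ?thesis
    by (simp add: cusp_angle_def[abs_def])
qed

lemma cusp_AB_deriv:
  assumes \<mu>: "smooth_on (J \<times> {-\<epsilon><..<\<epsilon>}) \<mu>" and s: "s \<in> J" "\<bar>t\<bar> < \<epsilon>"
  shows "(cusp_A \<mu> s has_real_derivative t * cos (cusp_angle \<mu> s t)) (at t)"
    and "(cusp_B \<mu> s has_real_derivative t * sin (cusp_angle \<mu> s t)) (at t)"
proof -
  have c: "continuous_on {-\<epsilon><..<\<epsilon>} (cusp_angle \<mu> s)"
    by (intro continuous_at_imp_continuous_on ballI DERIV_isCont[OF cusp_angle_deriv[OF \<mu> s(1)]]) auto
  show "(cusp_A \<mu> s has_real_derivative t * cos (cusp_angle \<mu> s t)) (at t)"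
    unfolding cusp_A_def[abs_def]
    by (rule interval_integral_has_derivative[OF _ s(2)]) (intro continuous_intros c)
  show "(cusp_B \<mu> s has_real_derivative t * sin (cusp_angle \<mu> s t)) (at t)"
    unfolding cusp_B_def[abs_def]
    by (rule interval_integral_has_derivative[OF _ s(2)]) (intro continuous_intros c)
qed

lemma normal_form_map_deriv_t:
  assumes \<mu>: "smooth_on (J \<times> {-\<epsilon><..<\<epsilon>}) \<mu>" and s: "s \<in> J" "\<bar>t\<bar> < \<epsilon>"
  shows "((\<lambda>x. normal_form_map c \<gamma> \<theta> \<mu> (s, x)) has_vector_derivative t *\<^sub>R cusp_direction \<gamma> \<theta> \<mu> (s, t)) (at t)"
proof -
  note AB = cusp_AB_deriv[OF assms]
  let ?a = "cusp_angle \<mu> s t"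
  let ?X = "t * cos ?a * cos (\<theta> s) + t * sin ?a * sin (\<theta> s)"
  let ?Y = "- (t * cos ?a) * sin (\<theta> s) + t * sin ?a * cos (\<theta> s)"
  have "((\<lambda>x. normal_form_map c \<gamma> \<theta> \<mu> (s, x)) has_vector_derivative
     0 + ?X *\<^sub>R in_space (left_normal \<gamma> s) 0 + ?Y *\<^sub>R in_space 0 1) (at t)"
    unfolding normal_form_map_def prod.case Let_def
    by (rule has_vector_derivative_add has_vector_derivative_const
        has_vector_derivative_scaleR[where g = "\<lambda>_. z" for z, OF _ has_vector_derivative_const, simplified]
        DERIV_add DERIV_cmult_right DERIV_minus AB)+
  moreover have "0 + ?X *\<^sub>R in_space (left_normal \<gamma> s) 0 + ?Y *\<^sub>R in_space 0 1
      = t *\<^sub>R cusp_direction \<gamma> \<theta> \<mu> (s, t)"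
    by (simp add: vec_eq_iff forall_3 cusp_direction_def cos_diff sin_diff algebra_simps)
  ultimately show ?thesis by simp
qed

lemma cusp_direction_deriv_t:
  assumes \<mu>: "smooth_on (J \<times> {-\<epsilon><..<\<epsilon>}) \<mu>" and s: "s \<in> J" "\<bar>t\<bar> < \<epsilon>"
  shows "((\<lambda>x. cusp_direction \<gamma> \<theta> \<mu> (s, x) $ i) has_real_derivative
    \<mu> (s, t) * (in_space (sin (\<theta> s - cusp_angle \<mu> s t) *\<^sub>R left_normal \<gamma> s)
       (cos (\<theta> s - cusp_angle \<mu> s t)) $ i)) (at t)"
proof -
  note a = cusp_angle_deriv[OF assms]
  have "i = 1 \<or> i = 2 \<or> i = 3" using exhaust_3 by blast
  then show ?thesis
    unfolding cusp_direction_def prod.case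
    by (elim disjE) (auto intro!: derivative_eq_intros a)
qed

lemma normal_form_map_0: "normal_form_map c \<gamma> \<theta> \<mu> (s, 0) = c + in_space (\<gamma> s) s"
  by (simp add: normal_form_map_def cusp_A_def cusp_B_def zero_ereal_def[symmetric])

section \<open>Derivatives of the singular curve\<close>
lemma pd_compose:
  assumes "\<phi> differentiable (at x)" "f differentiable (at (\<phi> x))"
  shows "pd v (\<lambda>x. f (\<phi> x)) x = pd (pd v \<phi> x) f (\<phi> x)"
  by (rule pd_eqI[OF has_derivative_compose[OF has_derivative_pd[OF assms(1)] has_derivative_pd[OF assms(2)]]])

lemma bounded_linear_in_space: "bounded_linear (\<lambda>p. in_space (fst p) (snd p))"
  unfolding linear_conv_bounded_linear[symmetric]
  by (rule linearI) (simp_all add: in_space_lin)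

lemma has_vector_derivative_in_space:
  assumes "(a has_vector_derivative a') (at x)" "(b has_vector_derivative b') (at x)"
  shows "((\<lambda>x. in_space (a x) (b x)) has_vector_derivative in_space a' b') (at x)"
  using bounded_linear.has_vector_derivative[OF bounded_linear_in_space
    has_vector_derivative_Pair[OF assms]] by simp

lemma velocity_sing_curve:
  "f differentiable (at (s, 0)) \<Longrightarrow> velocity (sing_curve f) s = ps f (s, 0)"
  by (simp add: velocity_def sing_curve_def vector_derivative_at has_vector_derivative_ps)

lemma d_t_d_t_eq_pt_pt:
  assumes "open S" "smooth_on S f" "p \<in> S"
  shows "d_t (d_t f) p = pt (pt f) p"
proof -
  have eq: "d_t f x = pt f x" if "x \<in> S" for x
    by (rule d_t_eq_pt[OF smooth_on_differentiable[OF assms(2) that]])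
  have sm: "smooth_on S (d_t f)"
    by (rule smooth_on_cong[OF assms(1) smooth_on_pd[OF assms(2)]]) (rule eq[symmetric])
  note d = smooth_on_differentiable[OF sm assms(3)]
  show ?thesis
    using d_t_eq_pt[OF d] pd_cong[OF assms(1) eq assms(3) d] by simp
qed

lemma eventually_axis:
  fixes S :: "(real \<times> real) set"
  assumes "open S" "(s, 0) \<in> S" "(a \<longlongrightarrow> s) F"
  shows "\<forall>\<^sub>F x in F. (a x, 0) \<in> S"
proof -
  have "((\<lambda>x. (a x, 0)) \<longlongrightarrow> (s, 0::real)) F" by (intro tendsto_intros assms)
  from topological_tendstoD[OF this assms(1,2)] show ?thesis .
qed

lemma velocity_velocity_sing_curve:
  assumes S: "open S" and f: "smooth_on S f" and s: "(s, 0) \<in> S"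
  shows "velocity (velocity (sing_curve f)) s = ps (ps f) (s, 0)"
proof -
  have "\<forall>\<^sub>F x in nhds s. (x, 0) \<in> S"
    by (rule eventually_axis[OF S s]) (rule filterlim_ident)
  then have "\<forall>\<^sub>F x in nhds s. velocity (sing_curve f) x = ps f (x, 0)"
    by (rule eventually_mono) (rule velocity_sing_curve[OF smooth_on_differentiable[OF f]])
  then have "vector_derivative (velocity (sing_curve f)) (at s) = vector_derivative (\<lambda>x. ps f (x, 0)) (at s)"
    by (intro vector_derivative_cong_eq) (auto elim: eventually_mono dest: eventually_nhds_x_imp_x)
  also have "\<dots> = ps (ps f) (s, 0)"
    by (rule vector_derivative_at[OF has_vector_derivative_ps[OF smooth_on_differentiable[OF smooth_on_pd[OF f] s]]])
  finally show ?thesis by (simp add: velocity_def[of "velocity _"])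
qed

lemma has_vector_derivative_quotient:
  fixes F :: "real \<Rightarrow> real ^ 'n"
  assumes "(F has_vector_derivative F') (at 0)" "F 0 = 0"
  shows "((\<lambda>t. (1 / t) *\<^sub>R F t) \<longlongrightarrow> F') (at 0)"
proof (rule vec_tendstoI)
  fix i
  have "((\<lambda>t. F t $ i) has_real_derivative F' $ i) (at 0)"
    unfolding has_real_derivative_iff_has_vector_derivative
    by (rule bounded_linear.has_vector_derivative[OF bounded_linear_vec_nth assms(1)])
  then show "((\<lambda>t. ((1 / t) *\<^sub>R F t) $ i) \<longlongrightarrow> F' $ i) (at 0)"
    by (simp add: has_field_derivative_iff assms(2))
qed

section \<open>A cuspidal edge in normal form\<close>

text \<open>
  The differential data of a generalized cuspidal edge \<open>f\<close> on \<open>S\<close> with a normal form for it on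
  \<open>J \<times> {-\<epsilon><..<\<epsilon>}\<close>.  The coordinate change \<open>\<phi>\<close> enters as an immersion that preserves the
  singular set.
\<close>
locale cuspidal_normal_form =
  fixes f :: "real \<times> real \<Rightarrow> real ^ 3" and S :: "(real \<times> real) set"
    and J :: "real set" and \<epsilon> :: real and \<phi> :: "real \<times> real \<Rightarrow> real \<times> real"
    and c :: "real ^ 3" and \<gamma> :: "real \<Rightarrow> real ^ 2" and \<theta> :: "real \<Rightarrow> real"
    and \<mu> :: "real \<times> real \<Rightarrow> real"
  assumes open_S: "open S" and smooth_f: "smooth_on S f"
    and f_t: "\<And>s. (s, 0) \<in> S \<Longrightarrow> pt f (s, 0) = 0"
    and f_s: "\<And>s. (s, 0) \<in> S \<Longrightarrow> ps f (s, 0) \<noteq> 0"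
    and open_J: "open J" and eps: "\<epsilon> > 0"
    and smooth_\<phi>: "smooth_on (J \<times> {-\<epsilon><..<\<epsilon>}) \<phi>"
    and \<phi>_in: "\<And>x. x \<in> J \<times> {-\<epsilon><..<\<epsilon>} \<Longrightarrow> \<phi> x \<in> S"
    and \<phi>_immersion: "\<And>x v. x \<in> J \<times> {-\<epsilon><..<\<epsilon>} \<Longrightarrow> pd v \<phi> x = 0 \<Longrightarrow> v = 0"
    and \<phi>_axis: "\<And>\<sigma>. \<sigma> \<in> J \<Longrightarrow> snd (\<phi> (\<sigma>, 0)) = 0"
    and smooth_\<gamma>: "smooth_on J \<gamma>" and unit_\<gamma>: "\<And>\<sigma>. \<sigma> \<in> J \<Longrightarrow> norm (velocity \<gamma> \<sigma>) = 1"
    and smooth_\<theta>: "smooth_on J \<theta>" and smooth_\<mu>: "smooth_on (J \<times> {-\<epsilon><..<\<epsilon>}) \<mu>"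
    and f_\<phi>: "\<And>x. x \<in> J \<times> {-\<epsilon><..<\<epsilon>} \<Longrightarrow> f (\<phi> x) = normal_form_map c \<gamma> \<theta> \<mu> x"
begin

abbreviation "R \<equiv> J \<times> {-\<epsilon><..<\<epsilon>}"
abbreviation "g \<equiv> normal_form_map c \<gamma> \<theta> \<mu>"
abbreviation "h \<equiv> cusp_direction \<gamma> \<theta> \<mu>"

text \<open>
  On \<open>S\<close> this is \<^const>\<open>Delta_L\<close> of \<open>f\<close>, in terms of partial derivatives that are known to be
  smooth.
\<close>
definition D :: "real \<times> real \<Rightarrow> real"
  where "D p = lorentz_gram (ps f p) (pt f p)"

definition Jac :: "real \<times> real \<Rightarrow> real"
  where "Jac x = fst (ps \<phi> x) * snd (pt \<phi> x) - snd (ps \<phi> x) * fst (pt \<phi> x)"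

lemma open_R: "open R" by (intro open_Times open_J open_greaterThanLessThan)

lemma axis_in_R: "\<sigma> \<in> J \<Longrightarrow> (\<sigma>, 0) \<in> R" using eps by simp

lemma smooth_g: "smooth_on R g"
  by (rule smooth_on_cong[OF open_R smooth_on_compose[OF open_R smooth_\<phi> \<phi>_in smooth_f]])
    (assumption, rule f_\<phi>)

lemma smooth_D: "smooth_on S D"
  unfolding D_def[abs_def]
  by (rule smooth_on_lorentz_gram[OF open_S smooth_on_pd[OF smooth_f] smooth_on_pd[OF smooth_f]])

lemma pd_g:
  assumes x: "x \<in> R"
  shows "pd v g x = fst (pd v \<phi> x) *\<^sub>R ps f (\<phi> x) + snd (pd v \<phi> x) *\<^sub>R pt f (\<phi> x)"
proof -
  note d\<phi> = smooth_on_differentiable[OF smooth_\<phi> x]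
  note df = smooth_on_differentiable[OF smooth_f \<phi>_in[OF x]]
  have "pd v g x = pd v (\<lambda>x. f (\<phi> x)) x"
    by (rule pd_cong[OF open_R f_\<phi> x differentiable_chain_at[OF d\<phi> df, unfolded o_def], symmetric])
  also have "\<dots> = pd (pd v \<phi> x) f (\<phi> x)" by (rule pd_compose[OF d\<phi> df])
  also have "\<dots> = fst (pd v \<phi> x) *\<^sub>R ps f (\<phi> x) + snd (pd v \<phi> x) *\<^sub>R pt f (\<phi> x)"
    by (rule pd_pair[OF df])
  finally show ?thesis .
qed

lemma gram_g: "x \<in> R \<Longrightarrow> lorentz_gram (ps g x) (pt g x) = (Jac x)\<^sup>2 * D (\<phi> x)"
  by (simp only: pd_g lorentz_gram_combination D_def Jac_def)

lemma pt_g: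
  assumes "(\<sigma>, t) \<in> R"
  shows "pt g (\<sigma>, t) = t *\<^sub>R h (\<sigma>, t)"
proof -
  have "((\<lambda>x. g (\<sigma>, x)) has_vector_derivative t *\<^sub>R h (\<sigma>, t)) (at t)"
    by (rule normal_form_map_deriv_t[OF smooth_\<mu>]) (use assms in auto)
  with has_vector_derivative_pt[OF smooth_on_differentiable[OF smooth_g assms]]
  show ?thesis by (rule vector_derivative_unique_at)
qed

lemma \<gamma>_deriv: "\<sigma> \<in> J \<Longrightarrow> (\<gamma> has_vector_derivative velocity \<gamma> \<sigma>) (at \<sigma>)"
  by (rule smooth_on_has_velocity[OF smooth_\<gamma>])

lemma ps_g_axis:
  assumes "\<sigma> \<in> J"
  shows "ps g (\<sigma>, 0) = in_space (velocity \<gamma> \<sigma>) 1"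
proof -
  have "((\<lambda>x. c + in_space (\<gamma> x) x) has_vector_derivative 0 + in_space (velocity \<gamma> \<sigma>) 1) (at \<sigma>)"
    by (intro has_vector_derivative_add has_vector_derivative_const has_vector_derivative_in_space
      \<gamma>_deriv assms has_vector_derivative_id)
  then have "((\<lambda>x. g (x, 0)) has_vector_derivative in_space (velocity \<gamma> \<sigma>) 1) (at \<sigma>)"
    by (simp add: normal_form_map_0)
  with has_vector_derivative_ps[OF smooth_on_differentiable[OF smooth_g axis_in_R[OF assms]]]
  show ?thesis by (rule vector_derivative_unique_at)
qed

lemma h_deriv:
  assumes "(\<sigma>, t) \<in> R"
  shows "((\<lambda>x. h (\<sigma>, x) $ i) has_real_derivative
    \<mu> (\<sigma>, t) * (in_space (sin (\<theta> \<sigma> - cusp_angle \<mu> \<sigma> t) *\<^sub>R left_normal \<gamma> \<sigma>)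
       (cos (\<theta> \<sigma> - cusp_angle \<mu> \<sigma> t)) $ i)) (at t)"
  by (rule cusp_direction_deriv_t[OF smooth_\<mu>]) (use assms in auto)

lemma h_lim: "\<sigma> \<in> J \<Longrightarrow> ((\<lambda>t. h (\<sigma>, t)) \<longlongrightarrow> h (\<sigma>, 0)) (at 0)"
  by (rule vec_tendstoI) (rule isContD[OF DERIV_isCont[OF h_deriv[OF axis_in_R]]])

lemma smooth_lim:
  "smooth_on R q \<Longrightarrow> \<sigma> \<in> J \<Longrightarrow> ((\<lambda>t. q (\<sigma>, t)) \<longlongrightarrow> q (\<sigma>, 0)) (at 0)"
  by (rule isCont_tendsto_compose[OF smooth_on_isCont[OF _ axis_in_R]])
    (auto intro!: tendsto_intros)

lemma ev_R: "\<sigma> \<in> J \<Longrightarrow> \<forall>\<^sub>F t in nhds 0. (\<sigma>, t) \<in> R"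
  using eventually_nhds_in_open[of "{-\<epsilon><..<\<epsilon>}" 0] eps by simp

lemma ev_R': "\<sigma> \<in> J \<Longrightarrow> \<forall>\<^sub>F t in at 0. (\<sigma>, t) \<in> R"
  using ev_R eventually_nhds_conv_at by blast

lemma ps_\<phi>_axis:
  assumes "\<sigma> \<in> J"
  shows "snd (ps \<phi> (\<sigma>, 0)) = 0"
proof -
  have "((\<lambda>x. snd (\<phi> (x, 0))) has_vector_derivative snd (ps \<phi> (\<sigma>, 0))) (at \<sigma>)"
    by (rule bounded_linear.has_vector_derivative[OF bounded_linear_snd
      has_vector_derivative_ps[OF smooth_on_differentiable[OF smooth_\<phi> axis_in_R[OF assms]]]])
  moreover have "((\<lambda>x. snd (\<phi> (x, 0))) has_vector_derivative 0) (at \<sigma>)"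
    by (rule has_vector_derivative_transform_within_open[OF has_vector_derivative_const open_J assms])
      (simp add: \<phi>_axis)
  ultimately show ?thesis by (rule vector_derivative_unique_at)
qed

lemma \<phi>_axis_eq: "\<sigma> \<in> J \<Longrightarrow> \<phi> (\<sigma>, 0) = (fst (\<phi> (\<sigma>, 0)), 0)"
  by (metis \<phi>_axis prod.collapse)

lemma axis_in_S: "\<sigma> \<in> J \<Longrightarrow> (fst (\<phi> (\<sigma>, 0)), 0) \<in> S"
  using \<phi>_in[OF axis_in_R] \<phi>_axis_eq by metis

text \<open>
  On the singular set \<open>f\<^sub>t = 0\<close>, so \<open>g\<^sub>t\<close> is the first component of \<open>\<phi>\<^sub>t\<close> times the
  nonzero vector \<open>f\<^sub>s\<close>; but \<open>g\<^sub>t = 0\<close> as well.  Thus \<open>\<phi>\<close> maps vertical lines to curves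
  that are vertical to first order.
\<close>
lemma pt_\<phi>_axis:
  assumes "\<sigma> \<in> J"
  shows "fst (pt \<phi> (\<sigma>, 0)) = 0"
proof -
  note S = axis_in_S[OF assms]
  have "pt g (\<sigma>, 0) = fst (pt \<phi> (\<sigma>, 0)) *\<^sub>R ps f (fst (\<phi> (\<sigma>, 0)), 0)"
    using pd_g[OF axis_in_R[OF assms], of "(0, 1)"] f_t[OF S] \<phi>_axis_eq[OF assms] by simp
  moreover have "pt g (\<sigma>, 0) = 0" using pt_g[OF axis_in_R[OF assms]] by simp
  ultimately show ?thesis using f_s[OF S] by simp
qed

lemma \<phi>_nondegenerate:
  assumes "\<sigma> \<in> J"
  shows "snd (pt \<phi> (\<sigma>, 0)) \<noteq> 0" "fst (ps \<phi> (\<sigma>, 0)) \<noteq> 0" "Jac (\<sigma>, 0) \<noteq> 0"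
proof -
  note im = \<phi>_immersion[OF axis_in_R[OF assms]]
  show 1: "snd (pt \<phi> (\<sigma>, 0)) \<noteq> 0"
    using im[of "(0, 1)"] pt_\<phi>_axis[OF assms] by (auto simp: prod_eq_iff)
  show 2: "fst (ps \<phi> (\<sigma>, 0)) \<noteq> 0"
    using im[of "(1, 0)"] ps_\<phi>_axis[OF assms] by (auto simp: prod_eq_iff)
  show "Jac (\<sigma>, 0) \<noteq> 0"
    using 1 2 by (simp add: Jac_def pt_\<phi>_axis[OF assms])
qed

lemma D_axis: "(s, 0) \<in> S \<Longrightarrow> D (s, 0) = 0"
  by (simp add: D_def f_t lorentz_gram_def lorentz_def)

text \<open>
  \<open>D\<close> is quadratic in \<open>f\<^sub>t\<close>, which vanishes at \<open>t = 0\<close>.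
\<close>
lemma D_axis_t:
  assumes "(s, 0) \<in> S"
  shows "pt D (s, 0) = 0"
proof -
  have "((\<lambda>t. D (s, t)) has_real_derivative pt D (s, 0)) (at 0)"
    by (rule has_real_derivative_pt[OF smooth_on_differentiable[OF smooth_D assms]])
  then have 1: "((\<lambda>t. D (s, t) / t) \<longlongrightarrow> pt D (s, 0)) (at 0)"
    using D_axis[OF assms] by (simp add: has_field_derivative_iff)
  have "((\<lambda>t. pt f (s, t)) has_vector_derivative pt (pt f) (s, 0)) (at 0)"
    by (rule has_vector_derivative_pt[OF smooth_on_differentiable[OF smooth_on_pd[OF smooth_f] assms]])
  then have 2: "((\<lambda>t. (1 / t) *\<^sub>R pt f (s, t)) \<longlongrightarrow> pt (pt f) (s, 0)) (at 0)"
    by (rule has_vector_derivative_quotient) (rule f_t[OF assms])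
  have 3: "((\<lambda>t. ps f (s, t)) \<longlongrightarrow> ps f (s, 0)) (at 0)"
    by (rule isCont_tendsto_compose[OF smooth_on_isCont[OF smooth_on_pd[OF smooth_f] assms]])
      (auto intro!: tendsto_intros)
  have "((\<lambda>t. t * lorentz_gram (ps f (s, t)) ((1 / t) *\<^sub>R pt f (s, t)))
     \<longlongrightarrow> 0 * lorentz_gram (ps f (s, 0)) (pt (pt f) (s, 0))) (at 0)"
    by (intro tendsto_intros 2 3)
  then have "((\<lambda>t. t * lorentz_gram (ps f (s, t)) ((1 / t) *\<^sub>R pt f (s, t))) \<longlongrightarrow> 0) (at 0)"
    by simp
  then have "((\<lambda>t. D (s, t) / t) \<longlongrightarrow> 0) (at 0)"
    by (rule Lim_transform_eventually)
      (auto simp: eventually_at_filter D_def lorentz_gram_scaleR power2_eq_square)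
  with 1 show ?thesis using LIM_unique by blast
qed

lemma b_lim:
  assumes "\<sigma> \<in> J"
  shows "((\<lambda>t. snd (\<phi> (\<sigma>, t)) / t) \<longlongrightarrow> snd (pt \<phi> (\<sigma>, 0))) (at 0)"
proof -
  have "((\<lambda>x. snd (\<phi> (\<sigma>, x))) has_vector_derivative snd (pt \<phi> (\<sigma>, 0))) (at 0)"
    by (rule bounded_linear.has_vector_derivative[OF bounded_linear_snd
      has_vector_derivative_pt[OF smooth_on_differentiable[OF smooth_\<phi> axis_in_R[OF assms]]]])
  then show ?thesis
    unfolding has_real_derivative_iff_has_vector_derivative[symmetric] has_field_derivative_iff
    by (simp add: \<phi>_axis[OF assms])
qed

lemma \<phi>_lims:
  assumes "\<sigma> \<in> J"
  shows "((\<lambda>t. fst (\<phi> (\<sigma>, t))) \<longlongrightarrow> fst (\<phi> (\<sigma>, 0))) (at 0)"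
    and "((\<lambda>t. snd (\<phi> (\<sigma>, t))) \<longlongrightarrow> 0) (at 0)"
    and "\<forall>\<^sub>F t in at 0. snd (\<phi> (\<sigma>, t)) \<noteq> 0"
proof -
  show "((\<lambda>t. fst (\<phi> (\<sigma>, t))) \<longlongrightarrow> fst (\<phi> (\<sigma>, 0))) (at 0)"
    by (rule tendsto_fst[OF smooth_lim[OF smooth_\<phi> assms]])
  show "((\<lambda>t. snd (\<phi> (\<sigma>, t))) \<longlongrightarrow> 0) (at 0)"
    using tendsto_snd[OF smooth_lim[OF smooth_\<phi> assms]] by (simp add: \<phi>_axis assms)
  have "\<forall>\<^sub>F t in at 0. snd (\<phi> (\<sigma>, t)) / t \<noteq> 0"
    by (rule tendsto_imp_eventually_ne[OF b_lim[OF assms] \<phi>_nondegenerate(1)[OF assms]])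
  then show "\<forall>\<^sub>F t in at 0. snd (\<phi> (\<sigma>, t)) \<noteq> 0"
    by (rule eventually_mono) auto
qed

lemma Jac_lim:
  assumes "\<sigma> \<in> J"
  shows "((\<lambda>t. Jac (\<sigma>, t)) \<longlongrightarrow> Jac (\<sigma>, 0)) (at 0)"
  unfolding Jac_def
  by (intro tendsto_intros smooth_lim[OF smooth_on_pd[OF smooth_\<phi>] assms])

lemma unit_\<gamma>': "\<sigma> \<in> J \<Longrightarrow> (velocity \<gamma> \<sigma> $ 1)\<^sup>2 + (velocity \<gamma> \<sigma> $ 2)\<^sup>2 = 1"
  using unit_\<gamma>[of \<sigma>] by (simp add: norm_vec_def L2_set_def UNIV_2)

lemma lorentz_P0_P0: "\<sigma> \<in> J \<Longrightarrow> lorentz (ps g (\<sigma>, 0)) (ps g (\<sigma>, 0)) = 0"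
  using unit_\<gamma>'[of \<sigma>] by (simp add: ps_g_axis lorentz_def power2_eq_square)

lemma lorentz_P0_h: "\<sigma> \<in> J \<Longrightarrow> lorentz (ps g (\<sigma>, 0)) (h (\<sigma>, t)) = sin (\<theta> \<sigma> - cusp_angle \<mu> \<sigma> t)"
  by (simp add: ps_g_axis lorentz_def cusp_direction_def)

text \<open>
  Hypothesis and conclusion both speak of the coefficient of \<open>t\<^sup>2\<close>: the Gram determinant of \<open>g\<close> divided by \<open>t\<^sup>2\<close>
  tends to that of \<open>e + v\<close> and \<open>h (\<sigma>, 0)\<close>, which is \<open>- sin\<^sup>2 \<theta>\<close>, and on the other hand to a
  multiple of the second derivative of \<open>D\<close>.
\<close>
lemma sin_zero_if_Delta_second_derivative_zero:
  assumes \<sigma>: "\<sigma> \<in> J" and D2: "(pt ^^ 2) D (fst (\<phi> (\<sigma>, 0)), 0) = 0"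
  shows "sin (\<theta> \<sigma>) = 0"
proof -
  let ?a = "\<lambda>t. fst (\<phi> (\<sigma>, t))" and ?b = "\<lambda>t. snd (\<phi> (\<sigma>, t))"
  note lims = \<phi>_lims[OF \<sigma>]
  have "((\<lambda>t. (D (?a t, ?b t) - (\<Sum>m<2. (pt ^^ m) D (?a t, 0) / fact m * ?b t ^ m)) / ?b t ^ 2)
     \<longlongrightarrow> (pt ^^ 2) D (?a 0, 0) / fact 2) (at 0)"
    by (rule taylor_along[OF smooth_D open_S axis_in_S[OF \<sigma>] lims])
  then have "((\<lambda>t. (D (?a t, ?b t) - (\<Sum>m<2. (pt ^^ m) D (?a t, 0) / fact m * ?b t ^ m)) / ?b t ^ 2)
     \<longlongrightarrow> 0) (at 0)"
    by (simp add: D2)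
  then have "((\<lambda>t. D (\<phi> (\<sigma>, t)) / ?b t ^ 2) \<longlongrightarrow> 0) (at 0)"
  proof (rule Lim_transform_eventually)
    show "\<forall>\<^sub>F t in at 0. (D (?a t, ?b t) - (\<Sum>m<2. (pt ^^ m) D (?a t, 0) / fact m * ?b t ^ m)) / ?b t ^ 2
       = D (\<phi> (\<sigma>, t)) / ?b t ^ 2"
      using eventually_axis[OF open_S axis_in_S[OF \<sigma>] lims(1)]
      by (rule eventually_mono) (simp add: numeral_2_eq_2 D_axis D_axis_t)
  qed
  then have "((\<lambda>t. (Jac (\<sigma>, t))\<^sup>2 * ((D (\<phi> (\<sigma>, t)) / ?b t ^ 2) * (?b t / t)\<^sup>2))
      \<longlongrightarrow> (Jac (\<sigma>, 0))\<^sup>2 * (0 * (snd (pt \<phi> (\<sigma>, 0)))\<^sup>2)) (at 0)"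
    by (intro tendsto_intros Jac_lim[OF \<sigma>] b_lim[OF \<sigma>])
  then have "((\<lambda>t. (Jac (\<sigma>, t))\<^sup>2 * ((D (\<phi> (\<sigma>, t)) / ?b t ^ 2) * (?b t / t)\<^sup>2)) \<longlongrightarrow> 0) (at 0)"
    by simp
  then have 1: "((\<lambda>t. lorentz_gram (ps g (\<sigma>, t)) (h (\<sigma>, t))) \<longlongrightarrow> 0) (at 0)"
  proof (rule Lim_transform_eventually)
    have "\<forall>\<^sub>F t in at 0. t \<noteq> (0::real)" by (simp add: eventually_at_filter)
    with ev_R'[OF \<sigma>] lims(3)
    show "\<forall>\<^sub>F t in at 0. (Jac (\<sigma>, t))\<^sup>2 * ((D (\<phi> (\<sigma>, t)) / ?b t ^ 2) * (?b t / t)\<^sup>2)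
      = lorentz_gram (ps g (\<sigma>, t)) (h (\<sigma>, t))"
    proof eventually_elim
      case (elim t)
      have "t\<^sup>2 * lorentz_gram (ps g (\<sigma>, t)) (h (\<sigma>, t)) = (Jac (\<sigma>, t))\<^sup>2 * D (\<phi> (\<sigma>, t))"
        using gram_g[OF elim(1)] pt_g[OF elim(1)] by (simp add: lorentz_gram_scaleR)
      with elim show ?case by (simp add: field_simps)
    qed
  qed
  have "((\<lambda>t. lorentz_gram (ps g (\<sigma>, t)) (h (\<sigma>, t))) \<longlongrightarrow> lorentz_gram (ps g (\<sigma>, 0)) (h (\<sigma>, 0))) (at 0)"
    by (intro tendsto_intros h_lim[OF \<sigma>] smooth_lim[OF smooth_on_pd[OF smooth_g] \<sigma>])
  from LIM_unique[OF this 1] show ?thesis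
    by (simp add: lorentz_gram_def lorentz_P0_P0[OF \<sigma>] lorentz_P0_h[OF \<sigma>])
qed

end

section \<open>The fourth-order coefficient\<close>
lemma pt_nth:
  fixes q :: "real \<times> real \<Rightarrow> real ^ 'n"
  assumes S: "open S" and q: "smooth_on S q" and p: "p \<in> S"
  shows "pt (\<lambda>x. q x $ i) p = pt q p $ i" and "pt (pt (\<lambda>x. q x $ i)) p = pt (pt q) p $ i"
proof -
  have 1: "pt (\<lambda>x. r x $ i) x = pt r x $ i" if "smooth_on S r" "x \<in> S" for r :: "real \<times> real \<Rightarrow> real ^ 'n" and x
    by (rule pd_bounded_linear[OF bounded_linear_vec_nth smooth_on_differentiable[OF that]])
  show "pt (\<lambda>x. q x $ i) p = pt q p $ i" by (rule 1[OF q p])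
  have sm: "smooth_on S (\<lambda>x. q x $ i)" by (rule smooth_on_bounded_linear[OF S bounded_linear_vec_nth q])
  have "pt (pt (\<lambda>x. q x $ i)) p = pt (\<lambda>x. pt q x $ i) p"
    by (rule pd_cong[OF S 1[OF q] p smooth_on_differentiable[OF smooth_on_pd[OF sm] p]])
  also have "\<dots> = pt (pt q) p $ i" by (rule 1[OF smooth_on_pd[OF q] p])
  finally show "pt (pt (\<lambda>x. q x $ i)) p = pt (pt q) p $ i" .
qed

lemma bounded_linear_rotation: "bounded_linear (\<lambda>x::real^2. vector [- (x $ 2), x $ 1] :: real^2)"
  unfolding linear_conv_bounded_linear[symmetric]
  by (rule linearI) (simp_all add: vec_eq_iff forall_2 vector_2)

context cuspidal_normal_form
begin

abbreviation "\<gamma>2 \<sigma> \<equiv> velocity (velocity \<gamma>) \<sigma>"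

lemma velocity_\<gamma>_deriv: "\<sigma> \<in> J \<Longrightarrow> (velocity \<gamma> has_vector_derivative \<gamma>2 \<sigma>) (at \<sigma>)"
  by (rule smooth_on_has_velocity[OF smooth_on_velocity[OF open_J smooth_\<gamma>]])

lemma left_normal_deriv:
  assumes "\<sigma> \<in> J"
  shows "(left_normal \<gamma> has_vector_derivative vector [- (\<gamma>2 \<sigma> $ 2), \<gamma>2 \<sigma> $ 1]) (at \<sigma>)"
  using bounded_linear.has_vector_derivative[OF bounded_linear_rotation velocity_\<gamma>_deriv[OF assms]]
  by (simp add: left_normal_def[abs_def])

lemma \<theta>_deriv: "\<sigma> \<in> J \<Longrightarrow> (\<theta> has_real_derivative velocity \<theta> \<sigma>) (at \<sigma>)"
  unfolding has_real_derivative_iff_has_vector_derivative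
  by (rule smooth_on_has_velocity[OF smooth_\<theta>])

lemma pt_g_axis: "\<sigma> \<in> J \<Longrightarrow> pt g (\<sigma>, 0) = 0"
  using pt_g[OF axis_in_R] by simp

lemma pt_pt_g:
  assumes \<sigma>: "\<sigma> \<in> J"
  shows "pt (pt g) (\<sigma>, 0) = h (\<sigma>, 0)"
proof -
  have "((\<lambda>t. pt g (\<sigma>, t)) has_vector_derivative pt (pt g) (\<sigma>, 0)) (at 0)"
    by (rule has_vector_derivative_pt[OF smooth_on_differentiable[OF smooth_on_pd[OF smooth_g] axis_in_R[OF \<sigma>]]])
  then have "((\<lambda>t. (1 / t) *\<^sub>R pt g (\<sigma>, t)) \<longlongrightarrow> pt (pt g) (\<sigma>, 0)) (at 0)"
    by (rule has_vector_derivative_quotient) (rule pt_g_axis[OF \<sigma>])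
  then have "((\<lambda>t. h (\<sigma>, t)) \<longlongrightarrow> pt (pt g) (\<sigma>, 0)) (at 0)"
  proof (rule Lim_transform_eventually)
    have "\<forall>\<^sub>F t in at 0. t \<noteq> (0::real)" by (simp add: eventually_at_filter)
    with ev_R'[OF \<sigma>] show "\<forall>\<^sub>F t in at 0. (1 / t) *\<^sub>R pt g (\<sigma>, t) = h (\<sigma>, t)"
      by eventually_elim (simp add: pt_g)
  qed
  from LIM_unique[OF this h_lim[OF \<sigma>]] show ?thesis .
qed

text \<open>
  Derivatives along the singular set can be computed from the values there, which are explicit.
\<close>
lemma ps_constant_on_axis:
  fixes q r :: "real \<times> real \<Rightarrow> real ^ 3"
  assumes q: "smooth_on R q" and \<sigma>: "\<sigma> \<in> J" and eq: "\<And>x. x \<in> J \<Longrightarrow> q (x, 0) = w x"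
    and w: "(w has_vector_derivative w') (at \<sigma>)"
  shows "ps q (\<sigma>, 0) = w'"
proof -
  have "((\<lambda>x. q (x, 0)) has_vector_derivative w') (at \<sigma>)"
    by (rule has_vector_derivative_transform_within_open[OF w open_J \<sigma>]) (rule eq[symmetric])
  with has_vector_derivative_ps[OF smooth_on_differentiable[OF q axis_in_R[OF \<sigma>]]]
  show ?thesis by (rule vector_derivative_unique_at)
qed

text \<open>
  After exchanging the order of differentiation, the second-order expansion of \<open>g\<^sub>s\<close> in \<open>t\<close> only
  involves \<open>g\<^sub>t\<close> and \<open>g\<^sub>t\<^sub>t = h\<close> on the singular set.  This replaces differentiating the integrals
  \<^const>\<open>cusp_A\<close> and \<^const>\<open>cusp_B\<close> in the parameter \<open>s\<close>.
\<close>
lemma pt_ps_g: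
  assumes \<sigma>: "\<sigma> \<in> J" and \<theta>': "velocity \<theta> \<sigma> = 0"
  shows "pt (ps g) (\<sigma>, 0) = 0"
    and "pt (pt (ps g)) (\<sigma>, 0) = in_space (cos (\<theta> \<sigma>) *\<^sub>R vector [- (\<gamma>2 \<sigma> $ 2), \<gamma>2 \<sigma> $ 1]) 0"
proof -
  note g' = smooth_on_pd[OF smooth_g] and \<sigma>R = axis_in_R[OF \<sigma>]
  have comm: "pt (ps q) x = ps (pt q) x" if "smooth_on R q" "x \<in> R" for q :: "real \<times> real \<Rightarrow> real^3" and x
    using ps_pt_commute[OF open_R that(1), of "fst x" "snd x"] that(2) by simp
  show "pt (ps g) (\<sigma>, 0) = 0"
    unfolding comm[OF smooth_g \<sigma>R]
    by (rule ps_constant_on_axis[OF g' \<sigma> _ has_vector_derivative_const]) (rule pt_g_axis)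
  have "pt (pt (ps g)) (\<sigma>, 0) = pt (ps (pt g)) (\<sigma>, 0)"
    by (rule pd_cong[OF open_R comm[OF smooth_g] \<sigma>R smooth_on_differentiable[OF smooth_on_pd[OF g'] \<sigma>R]])
  also have "\<dots> = ps (pt (pt g)) (\<sigma>, 0)" by (rule comm[OF g' \<sigma>R])
  also have "\<dots> = in_space (cos (\<theta> \<sigma>) *\<^sub>R vector [- (\<gamma>2 \<sigma> $ 2), \<gamma>2 \<sigma> $ 1]) 0"
  proof (rule ps_constant_on_axis[OF smooth_on_pd[OF g'] \<sigma>])
    show "pt (pt g) (x, 0) = in_space (cos (\<theta> x) *\<^sub>R left_normal \<gamma> x) (- sin (\<theta> x))" if "x \<in> J" for x
      by (simp add: pt_pt_g[OF that] cusp_direction_def)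
    have c: "((\<lambda>x. cos (\<theta> x)) has_real_derivative 0) (at \<sigma>)"
      and s: "((\<lambda>x. - sin (\<theta> x)) has_real_derivative 0) (at \<sigma>)"
      by (auto intro!: derivative_eq_intros \<theta>_deriv[OF \<sigma>] simp: \<theta>')
    have "((\<lambda>x. cos (\<theta> x) *\<^sub>R left_normal \<gamma> x) has_vector_derivative
        cos (\<theta> \<sigma>) *\<^sub>R vector [- (\<gamma>2 \<sigma> $ 2), \<gamma>2 \<sigma> $ 1] + 0 *\<^sub>R left_normal \<gamma> \<sigma>) (at \<sigma>)"
      by (rule has_vector_derivative_scaleR[OF c left_normal_deriv[OF \<sigma>]])
    then show "((\<lambda>x. in_space (cos (\<theta> x) *\<^sub>R left_normal \<gamma> x) (- sin (\<theta> x))) has_vector_derivative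
        in_space (cos (\<theta> \<sigma>) *\<^sub>R vector [- (\<gamma>2 \<sigma> $ 2), \<gamma>2 \<sigma> $ 1]) 0) (at \<sigma>)"
      using has_vector_derivative_in_space s
      by (simp add: has_real_derivative_iff_has_vector_derivative)
  qed
  finally show "pt (pt (ps g)) (\<sigma>, 0) = in_space (cos (\<theta> \<sigma>) *\<^sub>R vector [- (\<gamma>2 \<sigma> $ 2), \<gamma>2 \<sigma> $ 1]) 0" .
qed

text \<open>
  With \<open>g\<^sub>s = P + t\<^sup>2 Q\<close>, where \<open>P = e + v\<close> is light-like, the Gram determinant of \<open>g\<^sub>s\<close> and
  \<open>t h\<close> divided by \<open>t\<^sup>4\<close> is
  \<open>(2 \<langle>P,Q\<rangle> + t\<^sup>2 \<langle>Q,Q\<rangle>) \<langle>h,h\<rangle> - (\<langle>P,h\<rangle>/t + t \<langle>Q,h\<rangle>)\<^sup>2\<close>.  Here \<open>2 \<langle>P,Q\<rangle>\<close> tends to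
  \<open>- cos \<theta> \<kappa>\<close>, and \<open>\<langle>P,h\<rangle> = sin (\<theta> - \<lambda>)\<close> contributes \<open>\<mu>\<^sub>0\<close>.
\<close>
lemma gram_g_limit:
  assumes \<sigma>: "\<sigma> \<in> J" and sin: "sin (\<theta> \<sigma>) = 0" and \<theta>': "velocity \<theta> \<sigma> = 0"
  shows "((\<lambda>t. lorentz_gram (ps g (\<sigma>, t)) (pt g (\<sigma>, t)) / t ^ 4)
     \<longlongrightarrow> - (cos (\<theta> \<sigma>) * plane_curvature \<gamma> \<sigma> + (\<mu> (\<sigma>, 0))\<^sup>2)) (at 0)"
proof -
  let ?P = "\<lambda>t. ps g (\<sigma>, t)"
  let ?W = "in_space (cos (\<theta> \<sigma>) *\<^sub>R vector [- (\<gamma>2 \<sigma> $ 2), \<gamma>2 \<sigma> $ 1]) 0"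
  define Q where "Q t = (1 / t\<^sup>2) *\<^sub>R (?P t - ?P 0)" for t
  note g' = smooth_on_pd[OF smooth_g] and \<sigma>R = axis_in_R[OF \<sigma>]
  have Q: "(Q \<longlongrightarrow> (1 / 2) *\<^sub>R ?W) (at 0)"
  proof (rule vec_tendstoI)
    fix i
    have "smooth_on R (\<lambda>x. ps g x $ i)"
      by (rule smooth_on_bounded_linear[OF open_R bounded_linear_vec_nth g'])
    from taylor_along[where n = 2, OF this open_R \<sigma>R tendsto_const tendsto_ident_at[of 0 UNIV]]
    have "((\<lambda>t. (ps g (\<sigma>, t) $ i - (\<Sum>m<2. (pt ^^ m) (\<lambda>x. ps g x $ i) (\<sigma>, 0) / fact m * t ^ m)) / t ^ 2)
       \<longlongrightarrow> (pt ^^ 2) (\<lambda>x. ps g x $ i) (\<sigma>, 0) / fact 2) (at 0)"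
      by (simp add: eventually_at_filter)
    then show "((\<lambda>t. Q t $ i) \<longlongrightarrow> ((1 / 2) *\<^sub>R ?W) $ i) (at 0)"
      by (simp add: numeral_2_eq_2 pt_nth[OF open_R g' \<sigma>R] pt_ps_g[OF \<sigma> \<theta>'] Q_def)
  qed
  have "((\<lambda>t. sin (\<theta> \<sigma> - cusp_angle \<mu> \<sigma> t)) has_real_derivative - cos (\<theta> \<sigma>) * \<mu> (\<sigma>, 0)) (at 0)"
    using cusp_angle_deriv[OF smooth_\<mu> \<sigma>, of 0] eps by (auto intro!: derivative_eq_intros)
  then have L: "((\<lambda>t. lorentz (?P 0) (h (\<sigma>, t)) / t) \<longlongrightarrow> - cos (\<theta> \<sigma>) * \<mu> (\<sigma>, 0)) (at 0)"
    by (simp add: has_field_derivative_iff lorentz_P0_h[OF \<sigma>] sin)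
  have "((\<lambda>t. (2 * lorentz (?P 0) (Q t) + t\<^sup>2 * lorentz (Q t) (Q t)) * lorentz (h (\<sigma>, t)) (h (\<sigma>, t))
        - (lorentz (?P 0) (h (\<sigma>, t)) / t + t * lorentz (Q t) (h (\<sigma>, t)))\<^sup>2)
     \<longlongrightarrow> (2 * lorentz (?P 0) ((1 / 2) *\<^sub>R ?W) + 0\<^sup>2 * lorentz ((1 / 2) *\<^sub>R ?W) ((1 / 2) *\<^sub>R ?W))
         * lorentz (h (\<sigma>, 0)) (h (\<sigma>, 0))
        - (- cos (\<theta> \<sigma>) * \<mu> (\<sigma>, 0) + 0 * lorentz ((1 / 2) *\<^sub>R ?W) (h (\<sigma>, 0)))\<^sup>2) (at 0)"
    by (intro tendsto_intros Q L h_lim[OF \<sigma>])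
  moreover have "(2 * lorentz (?P 0) ((1 / 2) *\<^sub>R ?W) + 0\<^sup>2 * lorentz ((1 / 2) *\<^sub>R ?W) ((1 / 2) *\<^sub>R ?W))
         * lorentz (h (\<sigma>, 0)) (h (\<sigma>, 0))
        - (- cos (\<theta> \<sigma>) * \<mu> (\<sigma>, 0) + 0 * lorentz ((1 / 2) *\<^sub>R ?W) (h (\<sigma>, 0)))\<^sup>2
      = - (cos (\<theta> \<sigma>) * plane_curvature \<gamma> \<sigma> + (\<mu> (\<sigma>, 0))\<^sup>2)"
  proof -
    have c2: "(cos (\<theta> \<sigma>))\<^sup>2 = 1" using sin sin_cos_squared_add[of "\<theta> \<sigma>"] by simp
    have "lorentz (h (\<sigma>, 0)) (h (\<sigma>, 0)) = (cos (\<theta> \<sigma>))\<^sup>2 * ((velocity \<gamma> \<sigma> $ 1)\<^sup>2 + (velocity \<gamma> \<sigma> $ 2)\<^sup>2)"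
      by (simp add: cusp_direction_def lorentz_def sin power2_eq_square algebra_simps)
    then have "lorentz (h (\<sigma>, 0)) (h (\<sigma>, 0)) = 1" using c2 unit_\<gamma>'[OF \<sigma>] by simp
    moreover have "lorentz (?P 0) ?W = - (cos (\<theta> \<sigma>) * plane_curvature \<gamma> \<sigma>)"
      by (simp add: ps_g_axis[OF \<sigma>] lorentz_def vector_2 plane_curvature_def inner_vec_def UNIV_2 algebra_simps)
    ultimately show ?thesis using c2 by (simp add: power_mult_distrib)
  qed
  ultimately have "((\<lambda>t. (2 * lorentz (?P 0) (Q t) + t\<^sup>2 * lorentz (Q t) (Q t)) * lorentz (h (\<sigma>, t)) (h (\<sigma>, t))
        - (lorentz (?P 0) (h (\<sigma>, t)) / t + t * lorentz (Q t) (h (\<sigma>, t)))\<^sup>2)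
     \<longlongrightarrow> - (cos (\<theta> \<sigma>) * plane_curvature \<gamma> \<sigma> + (\<mu> (\<sigma>, 0))\<^sup>2)) (at 0)" by (simp only:)
  then show ?thesis
  proof (rule Lim_transform_eventually)
    have "\<forall>\<^sub>F t in at 0. t \<noteq> (0::real)" by (simp add: eventually_at_filter)
    with ev_R'[OF \<sigma>]
    show "\<forall>\<^sub>F t in at 0. (2 * lorentz (?P 0) (Q t) + t\<^sup>2 * lorentz (Q t) (Q t)) * lorentz (h (\<sigma>, t)) (h (\<sigma>, t))
        - (lorentz (?P 0) (h (\<sigma>, t)) / t + t * lorentz (Q t) (h (\<sigma>, t)))\<^sup>2
      = lorentz_gram (ps g (\<sigma>, t)) (pt g (\<sigma>, t)) / t ^ 4"
    proof eventually_elim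
      case (elim t)
      have P: "?P t = ?P 0 + t\<^sup>2 *\<^sub>R Q t" using elim(2) by (simp add: Q_def)
      have PP: "lorentz (?P t) (?P t) = t\<^sup>2 * (2 * lorentz (?P 0) (Q t) + t\<^sup>2 * lorentz (Q t) (Q t))"
        unfolding P by (simp add: lorentz_add lorentz_P0_P0[OF \<sigma>] lorentz_commute[of "Q t" "?P 0"] algebra_simps)
      have Ph: "lorentz (?P t) (h (\<sigma>, t)) = t * (lorentz (?P 0) (h (\<sigma>, t)) / t + t * lorentz (Q t) (h (\<sigma>, t)))"
        unfolding P using elim(2) by (simp add: lorentz_add power2_eq_square algebra_simps)
      show ?case
        unfolding pt_g[OF elim(1)] lorentz_gram_scaleR unfolding lorentz_gram_def PP Ph
        using elim(2) by (simp add: power2_eq_square power4_eq_xxxx field_simps)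
    qed
  qed
qed

text \<open>
  Expand \<open>D\<close> in its second variable at the moving point \<open>(a, b) = \<phi> (\<sigma>, t)\<close>.  The terms of
  order 2 and 3 have coefficients that vanish at \<open>s\<close>; as \<open>a - s = O(t\<^sup>2)\<close>, the first is
  \<open>o(t\<^sup>2)\<close> by the vanishing of its derivative and the second is \<open>O(t\<^sup>2)\<close>.  Multiplied by
  \<open>b\<^sup>2\<close> and \<open>b\<^sup>3\<close>, both disappear from the coefficient of \<open>t\<^sup>4\<close>.
\<close>
lemma D_\<phi>_limit:
  assumes \<sigma>: "\<sigma> \<in> J" and D2: "(pt ^^ 2) D (fst (\<phi> (\<sigma>, 0)), 0) = 0"
    and D2': "((\<lambda>x. (pt ^^ 2) D (x, 0)) has_real_derivative 0) (at (fst (\<phi> (\<sigma>, 0))))"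
    and D3: "(pt ^^ 3) D (fst (\<phi> (\<sigma>, 0)), 0) = 0"
  shows "((\<lambda>t. D (\<phi> (\<sigma>, t)) / t ^ 4)
     \<longlongrightarrow> (pt ^^ 4) D (fst (\<phi> (\<sigma>, 0)), 0) / 24 * (snd (pt \<phi> (\<sigma>, 0))) ^ 4) (at 0)"
proof -
  let ?a = "\<lambda>t. fst (\<phi> (\<sigma>, t))" and ?b = "\<lambda>t. snd (\<phi> (\<sigma>, t))"
  let ?s = "fst (\<phi> (\<sigma>, 0))"
  note lims = \<phi>_lims[OF \<sigma>] and \<sigma>R = axis_in_R[OF \<sigma>] and sS = axis_in_S[OF \<sigma>]
  \<comment> \<open>the curve has quadratic contact with the vertical line, because \<open>\<phi>\<^sub>t\<close> is vertical\<close>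
  obtain A where A: "((\<lambda>t. (?a t - ?s) / t\<^sup>2) \<longlongrightarrow> A) (at 0)"
  proof -
    have sm: "smooth_on R (\<lambda>x. fst (\<phi> x))"
      by (rule smooth_on_bounded_linear[OF open_R bounded_linear_fst smooth_\<phi>])
    have "pt (\<lambda>x. fst (\<phi> x)) (\<sigma>, 0) = 0"
      using pd_bounded_linear[OF bounded_linear_fst smooth_on_differentiable[OF smooth_\<phi> \<sigma>R]]
        pt_\<phi>_axis[OF \<sigma>] by simp
    then have "((\<lambda>t. (?a t - ?s) / t\<^sup>2) \<longlongrightarrow> (pt ^^ 2) (\<lambda>x. fst (\<phi> x)) (\<sigma>, 0) / fact 2) (at 0)"
      using taylor_along[where n = 2, OF sm open_R \<sigma>R tendsto_const tendsto_ident_at[of 0 UNIV]]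
      by (simp add: eventually_at_filter numeral_2_eq_2)
    then show ?thesis by (rule that)
  qed
  \<comment> \<open>Caratheodory's form of the derivative: \<open>E\<close> is \<open>w\<close> times \<open>a - s\<close> with \<open>w\<close> tending to \<open>l\<close>\<close>
  have linear_bound: "((\<lambda>t. E (?a t) / t\<^sup>2) \<longlongrightarrow> l * A) (at 0)"
    if E: "(E has_real_derivative l) (at ?s)" "E ?s = 0" for E l
  proof -
    obtain w where w: "\<And>z. E z - E ?s = w z * (z - ?s)" "isCont w ?s" "w ?s = l"
      using E(1) unfolding CARAT_DERIV by blast
    have "((\<lambda>t. w (?a t) * ((?a t - ?s) / t\<^sup>2)) \<longlongrightarrow> w ?s * A) (at 0)"
      by (intro tendsto_intros isCont_tendsto_compose[OF w(2)] lims(1) A)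
    then show ?thesis using w(1,3) E(2) by simp
  qed
  have E2: "((\<lambda>t. (pt ^^ 2) D (?a t, 0) / t\<^sup>2) \<longlongrightarrow> 0) (at 0)"
    using linear_bound[OF D2' D2] by simp
  have "((\<lambda>x. (pt ^^ 3) D (x, 0)) has_real_derivative ps ((pt ^^ 3) D) (?s, 0)) (at ?s)"
    unfolding has_real_derivative_iff_has_vector_derivative
    by (rule has_vector_derivative_ps[OF smooth_on_differentiable[OF smooth_on_funpow_pd[OF smooth_D] sS]])
  from linear_bound[OF this D3]
  have "((\<lambda>t. (pt ^^ 3) D (?a t, 0) / t\<^sup>2 * t) \<longlongrightarrow> ps ((pt ^^ 3) D) (?s, 0) * A * 0) (at 0)"
    by (intro tendsto_intros)
  then have E3: "((\<lambda>t. (pt ^^ 3) D (?a t, 0) / t\<^sup>2 * t) \<longlongrightarrow> 0) (at 0)" by simp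
  let ?T = "\<lambda>t. (D (?a t, ?b t) - (\<Sum>m<4. (pt ^^ m) D (?a t, 0) / fact m * ?b t ^ m)) / ?b t ^ 4"
  have T: "(?T \<longlongrightarrow> (pt ^^ 4) D (?s, 0) / fact 4) (at 0)"
    by (rule taylor_along[OF smooth_D open_S sS lims])
  have "((\<lambda>t. ?T t * (?b t / t) ^ 4 + (pt ^^ 2) D (?a t, 0) / t\<^sup>2 / 2 * (?b t / t) ^ 2
        + (pt ^^ 3) D (?a t, 0) / t\<^sup>2 * t / 6 * (?b t / t) ^ 3)
     \<longlongrightarrow> (pt ^^ 4) D (?s, 0) / fact 4 * (snd (pt \<phi> (\<sigma>, 0))) ^ 4 + 0 / 2 * (snd (pt \<phi> (\<sigma>, 0))) ^ 2
        + 0 / 6 * (snd (pt \<phi> (\<sigma>, 0))) ^ 3) (at 0)"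
    by (intro tendsto_add tendsto_mult tendsto_divide tendsto_power tendsto_const T E2 E3 b_lim[OF \<sigma>]) simp_all
  then have "((\<lambda>t. ?T t * (?b t / t) ^ 4 + (pt ^^ 2) D (?a t, 0) / t\<^sup>2 / 2 * (?b t / t) ^ 2
        + (pt ^^ 3) D (?a t, 0) / t\<^sup>2 * t / 6 * (?b t / t) ^ 3)
     \<longlongrightarrow> (pt ^^ 4) D (?s, 0) / 24 * (snd (pt \<phi> (\<sigma>, 0))) ^ 4) (at 0)"
    by (simp add: fact_numeral)
  then show ?thesis
  proof (rule Lim_transform_eventually)
    have "\<forall>\<^sub>F t in at 0. t \<noteq> (0::real)" by (simp add: eventually_at_filter)
    with eventually_axis[OF open_S sS lims(1)] lims(3)
    show "\<forall>\<^sub>F t in at 0. ?T t * (?b t / t) ^ 4 + (pt ^^ 2) D (?a t, 0) / t\<^sup>2 / 2 * (?b t / t) ^ 2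
        + (pt ^^ 3) D (?a t, 0) / t\<^sup>2 * t / 6 * (?b t / t) ^ 3 = D (\<phi> (\<sigma>, t)) / t ^ 4"
    proof eventually_elim
      case (elim t)
      define X where "X = (pt ^^ 2) D (?a t, 0)"
      define Y where "Y = (pt ^^ 3) D (?a t, 0)"
      define B where "B = ?b t"
      have sum: "(\<Sum>m<4. (pt ^^ m) D (?a t, 0) / fact m * ?b t ^ m) = X / 2 * B\<^sup>2 + Y / 6 * B ^ 3"
        using D_axis[OF elim(1)] D_axis_t[OF elim(1)]
        by (simp add: X_def Y_def B_def eval_nat_numeral lessThan_Suc)
      have "(Z - (X / 2 * B\<^sup>2 + Y / 6 * B ^ 3)) / B ^ 4 * (B / t) ^ 4 + X / t\<^sup>2 / 2 * (B / t) ^ 2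
         + Y / t\<^sup>2 * t / 6 * (B / t) ^ 3 = Z / t ^ 4" for Z
        using elim(2,3) unfolding B_def[symmetric]
        by (simp add: field_simps power2_eq_square power3_eq_cube power4_eq_xxxx)
      then show ?case unfolding sum unfolding X_def[symmetric] Y_def[symmetric] B_def[symmetric]
        by (simp add: B_def)
    qed
  qed
qed

lemma fourth_derivative:
  assumes \<sigma>: "\<sigma> \<in> J" and D2: "(pt ^^ 2) D (fst (\<phi> (\<sigma>, 0)), 0) = 0"
    and D2': "((\<lambda>x. (pt ^^ 2) D (x, 0)) has_real_derivative 0) (at (fst (\<phi> (\<sigma>, 0))))"
    and D3: "(pt ^^ 3) D (fst (\<phi> (\<sigma>, 0)), 0) = 0"
    and \<theta>': "velocity \<theta> \<sigma> = 0"
  shows "(pt ^^ 4) D (fst (\<phi> (\<sigma>, 0)), 0) = 0 \<longleftrightarrow>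
    cos (\<theta> \<sigma>) * plane_curvature \<gamma> \<sigma> + (\<mu> (\<sigma>, 0))\<^sup>2 = 0"
proof -
  let ?D4 = "(pt ^^ 4) D (fst (\<phi> (\<sigma>, 0)), 0)"
  note sin = sin_zero_if_Delta_second_derivative_zero[OF \<sigma> D2]
  have "((\<lambda>t. (Jac (\<sigma>, t))\<^sup>2 * (D (\<phi> (\<sigma>, t)) / t ^ 4))
      \<longlongrightarrow> (Jac (\<sigma>, 0))\<^sup>2 * (?D4 / 24 * (snd (pt \<phi> (\<sigma>, 0))) ^ 4)) (at 0)"
    by (intro tendsto_intros Jac_lim[OF \<sigma>] D_\<phi>_limit[OF assms(1-4)])
  then have "((\<lambda>t. lorentz_gram (ps g (\<sigma>, t)) (pt g (\<sigma>, t)) / t ^ 4)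
      \<longlongrightarrow> (Jac (\<sigma>, 0))\<^sup>2 * (?D4 / 24 * (snd (pt \<phi> (\<sigma>, 0))) ^ 4)) (at 0)"
    by (rule Lim_transform_eventually)
      (use ev_R'[OF \<sigma>] in \<open>auto elim!: eventually_mono simp: gram_g\<close>)
  from LIM_unique[OF this gram_g_limit[OF \<sigma> sin \<theta>']]
  have "(Jac (\<sigma>, 0))\<^sup>2 * (?D4 / 24 * (snd (pt \<phi> (\<sigma>, 0))) ^ 4)
     = - (cos (\<theta> \<sigma>) * plane_curvature \<gamma> \<sigma> + (\<mu> (\<sigma>, 0))\<^sup>2)" .
  moreover have "(Jac (\<sigma>, 0))\<^sup>2 * (?D4 / 24 * (snd (pt \<phi> (\<sigma>, 0))) ^ 4) = 0 \<longleftrightarrow> ?D4 = 0"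
    using \<phi>_nondegenerate[OF \<sigma>] by simp
  ultimately show ?thesis by linarith
qed

end

section \<open>Diffeomorphisms and orders\<close>
lemma diffeo_inverse_differentiable:
  assumes "diffeo U V \<phi>" "y \<in> V"
  shows "inv_into U \<phi> differentiable (at y)"
  using assms by (auto simp: diffeo_def intro: smooth_on_differentiable)

lemma diffeo_immersion:
  assumes d: "diffeo U V \<phi>" and x: "x \<in> U" and v: "pd v \<phi> x = 0"
  shows "v = 0"
proof -
  have U: "open U" and inj: "inj_on \<phi> U" and V: "\<phi> x \<in> V" and sm: "smooth_on U \<phi>"
    using d x by (auto simp: diffeo_def bij_betw_def)
  note d\<phi> = smooth_on_differentiable[OF sm x]
  note dinv = diffeo_inverse_differentiable[OF d V]
  have "((\<lambda>x. inv_into U \<phi> (\<phi> x)) has_derivative (\<lambda>w. pd (pd w \<phi> x) (inv_into U \<phi>) (\<phi> x))) (at x)"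
    by (rule has_derivative_compose[OF has_derivative_pd[OF d\<phi>] has_derivative_pd[OF dinv]])
  then have "((\<lambda>x. x) has_derivative (\<lambda>w. pd (pd w \<phi> x) (inv_into U \<phi>) (\<phi> x))) (at x)"
    by (rule has_derivative_transform_within_open[OF _ U x]) (simp add: inj)
  from has_derivative_unique[OF this has_derivative_ident]
  have "pd (pd v \<phi> x) (inv_into U \<phi>) (\<phi> x) = v" by (rule fun_cong)
  then show ?thesis
    unfolding v using linear_0[OF has_derivative_linear[OF has_derivative_pd[OF dinv]]] by simp
qed

lemma has_vector_derivative_chain:
  assumes y: "(y has_vector_derivative y') (at t)" and F: "F differentiable (at (y t))"
  shows "((\<lambda>t. F (y t)) has_vector_derivative pd y' F (y t)) (at t)"
proof -
  have "((\<lambda>t. F (y t)) has_derivative (\<lambda>r. pd (r *\<^sub>R y') F (y t))) (at t)"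
    using has_derivative_compose[OF y[unfolded has_vector_derivative_def] has_derivative_pd[OF F]] .
  then show ?thesis
    unfolding has_vector_derivative_def
    by (rule has_derivative_eq_rhs)
      (rule ext, rule linear_scale[OF has_derivative_linear[OF has_derivative_pd[OF F]]])
qed

lemma enat_le_sing_order_iff:
  "enat n \<le> sing_order f s \<longleftrightarrow> (\<forall>k<n. (deriv ^^ k) (\<lambda>t. Delta_L f (s, t)) 0 = 0)"
proof -
  have "enat n \<le> sing_order f s \<longleftrightarrow> (\<forall>k. (deriv ^^ k) (\<lambda>t. Delta_L f (s, t)) 0 \<noteq> 0 \<longrightarrow> n \<le> k)"
    by (simp add: sing_order_def le_INF_iff)
  then show ?thesis by (metis not_le)
qed

context cuspidal_normal_form
begin

lemma enat_le_sing_order_iff_D: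
  assumes s: "(s, 0) \<in> S"
  shows "enat n \<le> sing_order f s \<longleftrightarrow> (\<forall>k<n. (pt ^^ k) D (s, 0) = 0)"
proof -
  have "(deriv ^^ k) (\<lambda>t. Delta_L f (s, t)) 0 = (pt ^^ k) D (s, 0)" for k
  proof -
    have "((\<lambda>t. (s, t)) \<longlongrightarrow> (s, 0::real)) (nhds 0)"
      by (intro tendsto_intros filterlim_ident)
    from topological_tendstoD[OF this open_S s]
    have "\<forall>\<^sub>F t in nhds 0. Delta_L f (s, t) = D (s, t)"
      by (rule eventually_mono)
        (simp add: Delta_L_def D_def lorentz_gram_def d_s_eq_ps d_t_eq_pt smooth_on_differentiable[OF smooth_f])
    then have "(deriv ^^ k) (\<lambda>t. Delta_L f (s, t)) 0 = (deriv ^^ k) (\<lambda>t. D (s, t)) 0"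
      by (rule higher_deriv_cong_ev) simp
    then show ?thesis using deriv_funpow_eq_pt[OF smooth_D open_S s] by simp
  qed
  then show ?thesis by (simp add: enat_le_sing_order_iff)
qed

section \<open>The sign of the singular curvature\<close>

text \<open>
  Differentiating \<open>g = f \<circ> \<phi>\<close> once and twice along the singular set, and twice across it, relates
  the frame of the normal form to \<open>\<Gamma>'\<close>, \<open>\<Gamma>''\<close> and \<open>f\<^sub>t\<^sub>t\<close>.  What matters is that modulo
  \<open>\<Gamma>'\<close> the vectors are rescaled by the positive factors \<open>p\<^sup>2\<close> and \<open>r\<^sup>2\<close>, whichever way
  \<open>\<phi>\<close> is oriented.
\<close>
lemma singular_frame:
  assumes \<sigma>: "\<sigma> \<in> J" and sin: "sin (\<theta> \<sigma>) = 0"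
  defines "b \<equiv> ps f (\<phi> (\<sigma>, 0))"
  obtains p p' q r where "p \<noteq> 0" "r \<noteq> 0" "in_space (velocity \<gamma> \<sigma>) 1 = p *\<^sub>R b"
    "in_space (\<gamma>2 \<sigma>) 0 = p' *\<^sub>R b + p\<^sup>2 *\<^sub>R ps (ps f) (\<phi> (\<sigma>, 0))"
    "cos (\<theta> \<sigma>) *\<^sub>R in_space (left_normal \<gamma> \<sigma>) 0 = q *\<^sub>R b + r\<^sup>2 *\<^sub>R pt (pt f) (\<phi> (\<sigma>, 0))"
proof -
  note \<sigma>R = axis_in_R[OF \<sigma>]
  note d\<phi> = smooth_on_differentiable[OF smooth_\<phi> \<sigma>R]
  note \<phi>' = smooth_on_pd[OF smooth_\<phi>]
  note f' = smooth_on_pd[OF smooth_f]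
  have f0: "pt f (\<phi> (\<sigma>, 0)) = 0" using f_t[OF axis_in_S[OF \<sigma>]] \<phi>_axis_eq[OF \<sigma>] by simp
  note df = smooth_on_differentiable[OF f' \<phi>_in[OF \<sigma>R]]
  define p where "p = fst (ps \<phi> (\<sigma>, 0))"
  define r where "r = snd (pt \<phi> (\<sigma>, 0))"
  define p' where "p' = fst (ps (ps \<phi>) (\<sigma>, 0))"
  define q where "q = fst (pt (pt \<phi>) (\<sigma>, 0))"
  have axis: "ps g (x, 0) = fst (ps \<phi> (x, 0)) *\<^sub>R ps f (\<phi> (x, 0))" if "x \<in> J" for x
    by (simp add: pd_g[OF axis_in_R[OF that]] ps_\<phi>_axis[OF that])
  have 1: "in_space (velocity \<gamma> \<sigma>) 1 = p *\<^sub>R b"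
    using axis[OF \<sigma>] ps_g_axis[OF \<sigma>] by (simp add: b_def p_def)
  have "ps (ps g) (\<sigma>, 0) = in_space (\<gamma>2 \<sigma>) 0"
    by (rule ps_constant_on_axis[OF smooth_on_pd[OF smooth_g] \<sigma> ps_g_axis
      has_vector_derivative_in_space[OF velocity_\<gamma>_deriv[OF \<sigma>] has_vector_derivative_const]])
  moreover have "ps (ps g) (\<sigma>, 0) = p *\<^sub>R pd (ps \<phi> (\<sigma>, 0)) (ps f) (\<phi> (\<sigma>, 0)) + p' *\<^sub>R b"
    unfolding p_def p'_def b_def
  proof (rule ps_constant_on_axis[OF smooth_on_pd[OF smooth_g] \<sigma> axis has_vector_derivative_scaleR])
    show "((\<lambda>x. fst (ps \<phi> (x, 0))) has_real_derivative fst (ps (ps \<phi>) (\<sigma>, 0))) (at \<sigma>)"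
      unfolding has_real_derivative_iff_has_vector_derivative
      by (rule bounded_linear.has_vector_derivative[OF bounded_linear_fst
        has_vector_derivative_ps[OF smooth_on_differentiable[OF \<phi>' \<sigma>R]]])
    show "((\<lambda>x. ps f (\<phi> (x, 0))) has_vector_derivative pd (ps \<phi> (\<sigma>, 0)) (ps f) (\<phi> (\<sigma>, 0))) (at \<sigma>)"
      by (rule has_vector_derivative_chain[OF has_vector_derivative_ps[OF d\<phi>] df])
  qed
  moreover have "pd (ps \<phi> (\<sigma>, 0)) (ps f) (\<phi> (\<sigma>, 0)) = p *\<^sub>R ps (ps f) (\<phi> (\<sigma>, 0))"
    using pd_pair[OF df, of "ps \<phi> (\<sigma>, 0)" "(1, 0)"] by (simp add: ps_\<phi>_axis[OF \<sigma>] p_def)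
  ultimately have 2: "in_space (\<gamma>2 \<sigma>) 0 = p' *\<^sub>R b + p\<^sup>2 *\<^sub>R ps (ps f) (\<phi> (\<sigma>, 0))"
    by (simp add: power2_eq_square add.commute)
  have fs: "((\<lambda>t. ps f (\<phi> (\<sigma>, t))) has_vector_derivative pd (pt \<phi> (\<sigma>, 0)) (ps f) (\<phi> (\<sigma>, 0))) (at 0)"
    and ft: "((\<lambda>t. pt f (\<phi> (\<sigma>, t))) has_vector_derivative pd (pt \<phi> (\<sigma>, 0)) (pt f) (\<phi> (\<sigma>, 0))) (at 0)"
    by (rule has_vector_derivative_chain[OF has_vector_derivative_pt[OF d\<phi>] df])+
  have fst_\<phi>: "((\<lambda>t. fst (pt \<phi> (\<sigma>, t))) has_real_derivative fst (pt (pt \<phi>) (\<sigma>, 0))) (at 0)"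
    unfolding has_real_derivative_iff_has_vector_derivative
    by (rule bounded_linear.has_vector_derivative[OF bounded_linear_fst
      has_vector_derivative_pt[OF smooth_on_differentiable[OF \<phi>' \<sigma>R]]])
  have snd_\<phi>: "((\<lambda>t. snd (pt \<phi> (\<sigma>, t))) has_real_derivative snd (pt (pt \<phi>) (\<sigma>, 0))) (at 0)"
    unfolding has_real_derivative_iff_has_vector_derivative
    by (rule bounded_linear.has_vector_derivative[OF bounded_linear_snd
      has_vector_derivative_pt[OF smooth_on_differentiable[OF \<phi>' \<sigma>R]]])
  have "((\<lambda>t. fst (pt \<phi> (\<sigma>, t)) *\<^sub>R ps f (\<phi> (\<sigma>, t)) + snd (pt \<phi> (\<sigma>, t)) *\<^sub>R pt f (\<phi> (\<sigma>, t)))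
      has_vector_derivative
        (fst (pt \<phi> (\<sigma>, 0)) *\<^sub>R pd (pt \<phi> (\<sigma>, 0)) (ps f) (\<phi> (\<sigma>, 0)) + fst (pt (pt \<phi>) (\<sigma>, 0)) *\<^sub>R ps f (\<phi> (\<sigma>, 0)))
      + (snd (pt \<phi> (\<sigma>, 0)) *\<^sub>R pd (pt \<phi> (\<sigma>, 0)) (pt f) (\<phi> (\<sigma>, 0)) + snd (pt (pt \<phi>) (\<sigma>, 0)) *\<^sub>R pt f (\<phi> (\<sigma>, 0)))) (at 0)"
    by (intro has_vector_derivative_add has_vector_derivative_scaleR fst_\<phi> snd_\<phi> fs ft)
  moreover have "pd (pt \<phi> (\<sigma>, 0)) (pt f) (\<phi> (\<sigma>, 0)) = r *\<^sub>R pt (pt f) (\<phi> (\<sigma>, 0))"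
    using pd_pair[OF df, of "pt \<phi> (\<sigma>, 0)" "(0, 1)"] by (simp add: pt_\<phi>_axis[OF \<sigma>] r_def)
  ultimately have "((\<lambda>t. fst (pt \<phi> (\<sigma>, t)) *\<^sub>R ps f (\<phi> (\<sigma>, t)) + snd (pt \<phi> (\<sigma>, t)) *\<^sub>R pt f (\<phi> (\<sigma>, t)))
      has_vector_derivative (q *\<^sub>R b + r\<^sup>2 *\<^sub>R pt (pt f) (\<phi> (\<sigma>, 0)))) (at 0)"
    by (simp add: pt_\<phi>_axis[OF \<sigma>] f0 q_def r_def b_def power2_eq_square)
  then have "((\<lambda>t. pt g (\<sigma>, t)) has_vector_derivative (q *\<^sub>R b + r\<^sup>2 *\<^sub>R pt (pt f) (\<phi> (\<sigma>, 0)))) (at 0)"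
    by (rule has_vector_derivative_transform_within_open[of _ _ _ "{-\<epsilon><..<\<epsilon>}"])
      (use \<sigma> eps in \<open>auto simp: pd_g\<close>)
  from vector_derivative_unique_at[OF this has_vector_derivative_pt[OF smooth_on_differentiable[OF smooth_on_pd[OF smooth_g] \<sigma>R]]]
  have "q *\<^sub>R b + r\<^sup>2 *\<^sub>R pt (pt f) (\<phi> (\<sigma>, 0)) = h (\<sigma>, 0)" by (simp only: pt_pt_g[OF \<sigma>])
  then have 3: "cos (\<theta> \<sigma>) *\<^sub>R in_space (left_normal \<gamma> \<sigma>) 0 = q *\<^sub>R b + r\<^sup>2 *\<^sub>R pt (pt f) (\<phi> (\<sigma>, 0))"
    by (simp add: cusp_direction_def sin in_space_lin)
  show thesis
    by (rule that[OF _ _ 1 2 3]) (use \<phi>_nondegenerate[OF \<sigma>] in \<open>simp_all add: p_def r_def\<close>)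
qed

text \<open>
  The normal \<open>n\<close> is orthogonal to \<open>\<Gamma>'\<close>, so where \<open>sin \<theta> = 0\<close> the direction of the component of \<open>f\<^sub>t\<^sub>t\<close>
  orthogonal to \<open>\<Gamma>'\<close> is \<open>cos \<theta> n\<close>, and the normal component of \<open>\<Gamma>''\<close> is a positive multiple
  of \<open>\<kappa>\<close>.
\<close>
lemma concave_type_iff:
  assumes \<sigma>: "\<sigma> \<in> J" and sin: "sin (\<theta> \<sigma>) = 0"
  shows "concave_type f (fst (\<phi> (\<sigma>, 0))) \<longleftrightarrow> cos (\<theta> \<sigma>) * plane_curvature \<gamma> \<sigma> < 0"
proof -
  let ?s = "fst (\<phi> (\<sigma>, 0))" and ?n = "in_space (left_normal \<gamma> \<sigma>) 0"
  define a where "a = pt (pt f) (\<phi> (\<sigma>, 0))"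
  define b where "b = ps f (\<phi> (\<sigma>, 0))"
  define e where "e = ps (ps f) (\<phi> (\<sigma>, 0))"
  note sS = axis_in_S[OF \<sigma>]
  obtain p p' q r where pr: "p \<noteq> 0" "r \<noteq> 0" and P: "in_space (velocity \<gamma> \<sigma>) 1 = p *\<^sub>R b"
    and G: "in_space (\<gamma>2 \<sigma>) 0 = p' *\<^sub>R b + p\<^sup>2 *\<^sub>R e"
    and N: "cos (\<theta> \<sigma>) *\<^sub>R ?n = q *\<^sub>R b + r\<^sup>2 *\<^sub>R a"
    using that by (rule singular_frame[OF assms, folded a_def b_def e_def])
  have b: "b \<noteq> 0" unfolding b_def using f_s[OF sS] \<phi>_axis_eq[OF \<sigma>] by simp
  have "?n \<bullet> in_space (velocity \<gamma> \<sigma>) 1 = 0"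
    by (simp add: inner_vec_def sum_3)
  then have nb: "?n \<bullet> b = 0" using pr(1) by (simp add: P)
  have "?n \<bullet> ?n = 1" using unit_\<gamma>'[OF \<sigma>] by (simp add: inner_vec_def sum_3 power2_eq_square)
  then have n1: "norm ?n = 1" by (simp add: norm_eq_sqrt_inner)
  have ne: "?n \<bullet> e = plane_curvature \<gamma> \<sigma> / p\<^sup>2"
  proof -
    have "?n \<bullet> in_space (\<gamma>2 \<sigma>) 0 = plane_curvature \<gamma> \<sigma>"
      by (simp add: inner_vec_def sum_3 UNIV_2 plane_curvature_def)
    then show ?thesis using pr(1) by (simp add: G inner_add_right nb field_simps)
  qed
  have c: "(cos (\<theta> \<sigma>))\<^sup>2 = 1" using sin sin_cos_squared_add[of "\<theta> \<sigma>"] by simp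
  have "r\<^sup>2 *\<^sub>R a = cos (\<theta> \<sigma>) *\<^sub>R ?n - q *\<^sub>R b" using N by simp
  then have "(1 / r\<^sup>2) *\<^sub>R (r\<^sup>2 *\<^sub>R a) = (1 / r\<^sup>2) *\<^sub>R (cos (\<theta> \<sigma>) *\<^sub>R ?n - q *\<^sub>R b)" by simp
  then have a: "a = (cos (\<theta> \<sigma>) / r\<^sup>2) *\<^sub>R ?n - (q / r\<^sup>2) *\<^sub>R b"
    using pr(2) by (simp add: scaleR_diff_right)
  have "a - ((a \<bullet> b) / (b \<bullet> b)) *\<^sub>R b = (cos (\<theta> \<sigma>) / r\<^sup>2) *\<^sub>R ?n"
    unfolding a using b by (simp add: inner_diff_left nb)
  moreover have "sgn ((cos (\<theta> \<sigma>) / r\<^sup>2) *\<^sub>R ?n) = cos (\<theta> \<sigma>) *\<^sub>R ?n"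
  proof -
    have "sgn (cos (\<theta> \<sigma>) / r\<^sup>2) = cos (\<theta> \<sigma>)" 
      using c pr(2) by (auto simp: power2_eq_1_iff sgn_if)
    moreover have "sgn ?n = ?n" by (simp add: sgn_div_norm n1)
    ultimately show ?thesis by (simp only: sgn_scaleR)
  qed
  ultimately have "D_E f ?s = cos (\<theta> \<sigma>) *\<^sub>R ?n"
    using velocity_sing_curve[OF smooth_on_differentiable[OF smooth_f sS]] d_t_d_t_eq_pt_pt[OF open_S smooth_f sS]
      \<phi>_axis_eq[OF \<sigma>] by (simp add: D_E_def a_def b_def Let_def)
  then have "singular_curvature_E f ?s = (cos (\<theta> \<sigma>) * plane_curvature \<gamma> \<sigma>) / (p\<^sup>2 * (b \<bullet> b))"
    using velocity_sing_curve[OF smooth_on_differentiable[OF smooth_f sS]]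
      velocity_velocity_sing_curve[OF open_S smooth_f sS] \<phi>_axis_eq[OF \<sigma>] ne
    by (simp add: singular_curvature_E_def b_def e_def inner_commute)
  moreover have "p\<^sup>2 * (b \<bullet> b) > 0" using pr b by simp
  ultimately show ?thesis by (simp add: concave_type_def divide_less_0_iff)
qed

section \<open>Cuspidal edges have nonzero \<open>\<mu>\<^sub>0\<close>\<close>

text \<open>
  If \<open>\<mu>\<^sub>0 = 0\<close>, then \<open>h\<close> is constant to first order in \<open>t\<close>, so \<open>g (\<sigma>, \<cdot>)\<close> has no term of order
  3, and neither has its image \<open>(y\<^sub>1, y\<^sub>2\<^sup>2, y\<^sub>2\<^sup>3)\<close> under the diffeomorphism \<open>\<Phi>\<close> to the standard
  cuspidal edge; here \<open>y\<close> is the curve \<open>\<phi> (\<sigma>, \<cdot>)\<close> in the coordinates of the standard edge.  A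
  function of the form \<open>m t\<^sup>2/2 + o(t\<^sup>3)\<close> has zero derivative, which applies to \<open>y\<^sub>1\<close>, and is a
  cube of a differentiable function vanishing at 0 only if \<open>m = 0\<close> and the function has zero
  derivative, which applies to \<open>y\<^sub>2\<close>.  Hence \<open>y' = 0\<close>, contradicting the immersivity of \<open>\<phi>\<close>.
\<close>
lemma \<mu>_nonzero:
  assumes \<sigma>: "\<sigma> \<in> J" and ce: "cuspidal_edge_point T f (\<phi> (\<sigma>, 0))"
  shows "\<mu> (\<sigma>, 0) \<noteq> 0"
proof
  assume \<mu>0: "\<mu> (\<sigma>, 0) = 0"
  note \<sigma>R = axis_in_R[OF \<sigma>]
  from ce obtain U V \<psi> W Z \<Psi> where
    E: "diffeo U V \<psi> \<and> (0, 0) \<in> U \<and> V \<subseteq> T \<and> \<psi> (0, 0) = \<phi> (\<sigma>, 0) \<and>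
      diffeo W Z \<Psi> \<and> standard_cuspidal_edge ` U \<subseteq> W \<and>
      (\<forall>x\<in>U. f (\<psi> x) = \<Psi> (standard_cuspidal_edge x))"
    unfolding cuspidal_edge_point_def by (elim exE)
  have \<psi>: "diffeo U V \<psi>" "(0, 0) \<in> U" "\<psi> (0, 0) = \<phi> (\<sigma>, 0)"
    and \<Psi>: "diffeo W Z \<Psi>" and std: "standard_cuspidal_edge ` U \<subseteq> W"
    using E by simp_all
  have eq: "f (\<psi> x) = \<Psi> (standard_cuspidal_edge x)" if "x \<in> U" for x
    using E that by simp
  define \<Phi> where "\<Phi> = inv_into W \<Psi>"
  define y where "y t = inv_into U \<psi> (\<phi> (\<sigma>, t))" for t
  have U: "inj_on \<psi> U" "\<psi> ` U = V" "open V" "smooth_on U \<psi>" using \<psi>(1) by (auto simp: diffeo_def bij_betw_def)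
  have W: "inj_on \<Psi> W" "\<Psi> ` W = Z" "open Z" and sm\<Phi>: "smooth_on Z \<Phi>"
    using \<Psi> by (auto simp: diffeo_def bij_betw_def \<Phi>_def)
  have V0: "\<phi> (\<sigma>, 0) \<in> V" using \<psi>(2,3) U(2) by force
  have y0: "y 0 = (0, 0)" using inv_into_f_f[OF U(1) \<psi>(2)] by (simp add: y_def \<psi>(3))
  note \<phi>d = has_vector_derivative_pt[OF smooth_on_differentiable[OF smooth_\<phi> \<sigma>R]]
  have near: "\<forall>\<^sub>F t in nhds 0. (\<sigma>, t) \<in> R \<and> \<phi> (\<sigma>, t) \<in> V"
  proof -
    have "((\<lambda>t. \<phi> (\<sigma>, t)) \<longlongrightarrow> \<phi> (\<sigma>, 0)) (nhds 0)"
      by (rule isCont_tendsto_compose[where g = "\<lambda>t. \<phi> (\<sigma>, t)",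
          OF has_derivative_continuous[OF \<phi>d[unfolded has_vector_derivative_def]] filterlim_ident])
    from eventually_conj[OF ev_R[OF \<sigma>] topological_tendstoD[OF this U(3) V0]] show ?thesis .
  qed
  have std_y: "y t \<in> U" "\<psi> (y t) = \<phi> (\<sigma>, t)" "g (\<sigma>, t) \<in> Z" "\<Phi> (g (\<sigma>, t)) = standard_cuspidal_edge (y t)"
    if "(\<sigma>, t) \<in> R \<and> \<phi> (\<sigma>, t) \<in> V" for t
  proof -
    show 1: "y t \<in> U" unfolding y_def using that U(2) by (auto intro: inv_into_into)
    show 2: "\<psi> (y t) = \<phi> (\<sigma>, t)" unfolding y_def using that U(2) by (auto intro: f_inv_into_f)
    have 3: "g (\<sigma>, t) = \<Psi> (standard_cuspidal_edge (y t))" using eq[OF 1] f_\<phi>[of "(\<sigma>, t)"] that 2 by simp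
    have "standard_cuspidal_edge (y t) \<in> W" using std 1 by blast
    then show "g (\<sigma>, t) \<in> Z" "\<Phi> (g (\<sigma>, t)) = standard_cuspidal_edge (y t)"
      unfolding 3 \<Phi>_def using W(2) inv_into_f_f[OF W(1)] by auto
  qed
  note near0 = eventually_nhds_x_imp_x[OF near]
  define y' where "y' = pd (pt \<phi> (\<sigma>, 0)) (inv_into U \<psi>) (\<phi> (\<sigma>, 0))"
  have yd: "(y has_vector_derivative y') (at 0)"
    unfolding y_def y'_def
    by (rule has_vector_derivative_chain[OF \<phi>d diffeo_inverse_differentiable[OF \<psi>(1) V0]])
  have "y' \<noteq> 0"
  proof
    assume "y' = 0"
    have d\<psi>: "\<psi> differentiable (at (y 0))" using smooth_on_differentiable[OF U(4) \<psi>(2)] by (simp add: y0)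
    have "((\<lambda>t. \<psi> (y t)) has_vector_derivative pd y' \<psi> (y 0)) (at 0)"
      by (rule has_vector_derivative_chain[OF yd d\<psi>])
    moreover have "pd y' \<psi> (y 0) = 0"
      unfolding \<open>y' = 0\<close> by (rule linear_0[OF has_derivative_linear[OF has_derivative_pd[OF d\<psi>]]])
    ultimately have 0: "((\<lambda>t. \<psi> (y t)) has_vector_derivative 0) (at 0)" by simp
    have "\<forall>\<^sub>F t in nhds 0. t \<in> UNIV \<longrightarrow> \<psi> (y t) = \<phi> (\<sigma>, t)"
      using near by (rule eventually_mono) (simp add: std_y(2))
    from has_vector_derivative_cong_ev[OF this std_y(2)[OF near0]] 0
    have "((\<lambda>t. \<phi> (\<sigma>, t)) has_vector_derivative 0) (at 0)" by simp
    from vector_derivative_unique_at[OF this \<phi>d] have "pt \<phi> (\<sigma>, 0) = 0" by simp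
    from \<phi>_immersion[OF \<sigma>R this] show False by (simp add: zero_prod_def)
  qed
  have expansion: "\<exists>m. ((\<lambda>t. (standard_cuspidal_edge (y t) $ i - m * t\<^sup>2 / 2) / t ^ 3) \<longlongrightarrow> 0) (at 0)"
    if i: "standard_cuspidal_edge (0, 0) $ i = 0" for i
  proof -
    define k where "k t = \<Phi> (g (\<sigma>, t)) $ i" for t
    \<comment> \<open>\<open>D\<Phi>\<close> applied to \<open>h\<close>, so that the curve \<open>k\<close> has velocity \<open>t m\<close>\<close>
    define m where "m t = (\<Sum>j\<in>UNIV. h (\<sigma>, t) $ j * pd (axis j 1) \<Phi> (g (\<sigma>, t)) $ i)" for t
    note gd = has_vector_derivative_pt[OF smooth_on_differentiable[OF smooth_g]]
    have kd: "\<forall>\<^sub>F t in nhds 0. (k has_real_derivative t * m t) (at t)"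
      using near
    proof eventually_elim
      case (elim t)
      note d\<Phi> = smooth_on_differentiable[OF sm\<Phi> std_y(3)[OF elim]]
      note L = has_derivative_linear[OF has_derivative_pd[OF d\<Phi>]]
      have "((\<lambda>t. \<Phi> (g (\<sigma>, t))) has_vector_derivative pd (pt g (\<sigma>, t)) \<Phi> (g (\<sigma>, t))) (at t)"
        by (rule has_vector_derivative_chain[OF gd d\<Phi>]) (use elim in blast)
      from bounded_linear.has_vector_derivative[OF bounded_linear_vec_nth this, of i]
      have "(k has_real_derivative pd (pt g (\<sigma>, t)) \<Phi> (g (\<sigma>, t)) $ i) (at t)"
        by (simp add: has_real_derivative_iff_has_vector_derivative k_def[abs_def])
      moreover have "pt g (\<sigma>, t) = t *\<^sub>R (\<Sum>j\<in>UNIV. h (\<sigma>, t) $ j *\<^sub>R axis j 1)"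
        using pt_g[of \<sigma> t] elim basis_expansion[of "h (\<sigma>, t)"] by (simp add: scalar_mult_eq_scaleR)
      then have "pd (pt g (\<sigma>, t)) \<Phi> (g (\<sigma>, t)) = t *\<^sub>R (\<Sum>j\<in>UNIV. h (\<sigma>, t) $ j *\<^sub>R pd (axis j 1) \<Phi> (g (\<sigma>, t)))"
        by (simp only: linear_scale[OF L] linear_sum[OF L])
      ultimately show ?case by (simp add: m_def)
    qed
    have md: "(m has_real_derivative 0) (at 0)"
    proof -
      have h': "((\<lambda>t. h (\<sigma>, t) $ j) has_real_derivative 0) (at 0)" for j
        using h_deriv[OF \<sigma>R, of j] by (simp add: \<mu>0)
      have \<Phi>': "((\<lambda>t. pd (axis j 1) \<Phi> (g (\<sigma>, t)) $ i) has_real_derivative 0) (at 0)" for j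
      proof -
        note d\<Phi> = smooth_on_differentiable[OF smooth_on_pd[OF sm\<Phi>] std_y(3)[OF near0]]
        have "((\<lambda>t. pd (axis j 1) \<Phi> (g (\<sigma>, t))) has_vector_derivative
            pd (pt g (\<sigma>, 0)) (pd (axis j 1) \<Phi>) (g (\<sigma>, 0))) (at 0)"
          by (rule has_vector_derivative_chain[OF gd[OF \<sigma>R] d\<Phi>])
        moreover have "pd (pt g (\<sigma>, 0)) (pd (axis j 1) \<Phi>) (g (\<sigma>, 0)) = 0"
          unfolding pt_g_axis[OF \<sigma>] by (rule linear_0[OF has_derivative_linear[OF has_derivative_pd[OF d\<Phi>]]])
        ultimately show ?thesis
          using bounded_linear.has_vector_derivative[OF bounded_linear_vec_nth]
          by (fastforce simp: has_real_derivative_iff_has_vector_derivative)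
      qed
      have "(m has_real_derivative (\<Sum>j\<in>UNIV. 0 * pd (axis j 1) \<Phi> (g (\<sigma>, 0)) $ i + 0 * h (\<sigma>, 0) $ j)) (at 0)"
        unfolding m_def[abs_def] by (rule DERIV_sum) (rule DERIV_mult[OF h' \<Phi>'])
      then show ?thesis by simp
    qed
    have "k 0 = 0" using std_y(4)[OF near0] i by (simp add: k_def y0)
    with cusp_third_order[OF kd md]
    have "((\<lambda>t. (k t - m 0 * t\<^sup>2 / 2) / t ^ 3) \<longlongrightarrow> 0) (at 0)" by simp
    then have "((\<lambda>t. (standard_cuspidal_edge (y t) $ i - m 0 * t\<^sup>2 / 2) / t ^ 3) \<longlongrightarrow> 0) (at 0)"
    proof (rule Lim_transform_eventually)
      show "\<forall>\<^sub>F t in at 0. (k t - m 0 * t\<^sup>2 / 2) / t ^ 3 = (standard_cuspidal_edge (y t) $ i - m 0 * t\<^sup>2 / 2) / t ^ 3"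
        using near std_y(4) by (auto simp: k_def eventually_nhds_conv_at elim!: eventually_mono)
    qed
    then show ?thesis ..
  qed
  have nz: "\<forall>\<^sub>F t in at 0. t \<noteq> (0::real)" by (simp add: eventually_at_filter)
  have q1: "((\<lambda>t. fst (y t) / t) \<longlongrightarrow> fst y') (at 0)" and q2: "((\<lambda>t. snd (y t) / t) \<longlongrightarrow> snd y') (at 0)"
    using bounded_linear.has_vector_derivative[OF bounded_linear_fst yd]
      bounded_linear.has_vector_derivative[OF bounded_linear_snd yd]
    unfolding has_real_derivative_iff_has_vector_derivative[symmetric] has_field_derivative_iff
    by (simp_all add: y0)
  have std_nth: "standard_cuspidal_edge x $ 1 = fst x" "standard_cuspidal_edge x $ 3 = snd x ^ 3" for x
    by (cases x, simp add: standard_cuspidal_edge_def vector_3)+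
  have "fst y' = 0"
  proof -
    obtain m where m: "((\<lambda>t. (fst (y t) - m * t\<^sup>2 / 2) / t ^ 3) \<longlongrightarrow> 0) (at 0)"
      using expansion[of 1] by (auto simp: std_nth)
    have "((\<lambda>t. (fst (y t) - m * t\<^sup>2 / 2) / t ^ 3 * t\<^sup>2 + m * t / 2) \<longlongrightarrow> 0 * 0\<^sup>2 + m * 0 / 2) (at 0)"
      by (intro tendsto_intros m) simp
    then have "((\<lambda>t. (fst (y t) - m * t\<^sup>2 / 2) / t ^ 3 * t\<^sup>2 + m * t / 2) \<longlongrightarrow> 0) (at 0)" by simp
    then have "((\<lambda>t. fst (y t) / t) \<longlongrightarrow> 0) (at 0)"
      by (rule Lim_transform_eventually)
        (use nz in eventually_elim, simp add: field_simps power2_eq_square power3_eq_cube)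
    from LIM_unique[OF q1 this] show ?thesis .
  qed
  moreover have "snd y' = 0"
  proof -
    obtain m where m: "((\<lambda>t. (snd (y t) ^ 3 - m * t\<^sup>2 / 2) / t ^ 3) \<longlongrightarrow> 0) (at 0)"
      using expansion[of 3] by (auto simp: std_nth)
    have "((\<lambda>t. t * ((snd (y t) / t) ^ 3 - (snd (y t) ^ 3 - m * t\<^sup>2 / 2) / t ^ 3)) \<longlongrightarrow> 0 * ((snd y') ^ 3 - 0)) (at 0)"
      by (intro tendsto_intros m q2)
    then have "((\<lambda>t. t * ((snd (y t) / t) ^ 3 - (snd (y t) ^ 3 - m * t\<^sup>2 / 2) / t ^ 3)) \<longlongrightarrow> 0) (at 0)" by simp
    then have "((\<lambda>t::real. m / 2) \<longlongrightarrow> 0) (at 0)"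
      by (rule Lim_transform_eventually)
        (use nz in eventually_elim, simp add: field_simps power2_eq_square power3_eq_cube)
    then have "m = 0" using LIM_unique[OF tendsto_const] by fastforce
    then have "((\<lambda>t. (snd (y t) / t) ^ 3) \<longlongrightarrow> 0) (at 0)" using m by (simp add: power_divide)
    from LIM_unique[OF tendsto_power[OF q2] this] show ?thesis by simp
  qed
  ultimately show False using \<open>y' \<noteq> 0\<close> by (simp add: prod_eq_iff)
qed

end

section \<open>Order greater than 4\<close>
theorem propositionF:
  fixes f :: "real \<times> real \<Rightarrow> real ^ 3" and I J :: "real set" and \<delta> \<epsilon> s0 \<sigma>0 :: real
    and \<phi> :: "real \<times> real \<Rightarrow> real \<times> real" and c :: "real ^ 3" and \<gamma> :: "real \<Rightarrow> real ^ 2"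
    and \<theta> :: "real \<Rightarrow> real" and \<mu> :: "real \<times> real \<Rightarrow> real"
  assumes "cuspidal_edge I \<delta> f"
    and "type_L I (sing_curve f)"
    and "s0 \<in> I"
    and "sing_order f s0 \<ge> 4"
    and "order_ge4_not_isolated f s0"
    and "normal_form_at I \<delta> f s0 J \<epsilon> \<phi> c \<gamma> \<theta> \<mu> \<sigma>0"
  shows "sing_order f s0 > 4 \<longleftrightarrow>
    concave_type f s0 \<and> \<bar>plane_curvature \<gamma> \<sigma>0\<bar> = (\<mu> (\<sigma>0, 0))\<^sup>2"
proof -
  let ?S = "I \<times> {-\<delta><..<\<delta>}" and ?R = "J \<times> {-\<epsilon><..<\<epsilon>}"
  have gce: "open I" "\<delta> > 0" "smooth_on ?S f"
    "\<And>s. s \<in> I \<Longrightarrow> velocity (sing_curve f) s \<noteq> 0" "\<And>s. s \<in> I \<Longrightarrow> d_t f (s, 0) = 0"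
    using assms(1) unfolding cuspidal_edge_def generalized_cuspidal_edge_def by blast+
  obtain V where \<phi>: "diffeo ?R V \<phi>" and VS: "V \<subseteq> ?S"
    using assms(6) unfolding normal_form_at_def by blast
  have nf: "open J" "is_interval J" "\<sigma>0 \<in> J" "\<epsilon> > 0" "\<phi> (\<sigma>0, 0) = (s0, 0)"
    "\<And>\<sigma>. \<sigma> \<in> J \<Longrightarrow> snd (\<phi> (\<sigma>, 0)) = 0"
    "smooth_on J \<gamma>" "\<And>\<sigma>. \<sigma> \<in> J \<Longrightarrow> norm (velocity \<gamma> \<sigma>) = 1" "smooth_on J \<theta>" "smooth_on ?R \<mu>"
    "\<And>x. x \<in> ?R \<Longrightarrow> f (\<phi> x) = normal_form_map c \<gamma> \<theta> \<mu> x"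
    using assms(6) unfolding normal_form_at_def by blast+
  have \<phi>R: "smooth_on ?R \<phi>" "inj_on \<phi> ?R" "\<phi> ` ?R = V"
    using \<phi> by (auto simp: diffeo_def bij_betw_def)
  have openS: "open ?S" by (intro open_Times gce open_greaterThanLessThan)
  interpret cuspidal_normal_form f ?S J \<epsilon> \<phi> c \<gamma> \<theta> \<mu>
  proof
    fix s assume s: "(s, 0) \<in> ?S"
    note d = smooth_on_differentiable[OF gce(3) s]
    show "pt f (s, 0) = 0" using gce(5)[of s] s d_t_eq_pt[OF d] by simp
    show "ps f (s, 0) \<noteq> 0" using gce(4)[of s] s velocity_sing_curve[OF d] by simp
  qed (use \<phi>R VS in \<open>auto intro: openS gce nf diffeo_immersion[OF \<phi>]\<close>)
  have s0: "fst (\<phi> (\<sigma>0, 0)) = s0" by (simp add: nf(5))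
  have s0S: "(s0, 0) \<in> ?S" using assms(3) gce(2) by simp
  have order4: "(pt ^^ k) D (s, 0) = 0" if "sing_order f s \<ge> 4" "(s, 0) \<in> ?S" "k < 4" for s k
    using enat_le_sing_order_iff_D[OF that(2), of 4] that(1,3) by (simp add: numeral_eq_enat)
  have D23: "(pt ^^ 2) D (s0, 0) = 0" "(pt ^^ 3) D (s0, 0) = 0"
    by (rule order4[OF assms(4) s0S], simp)+
  note sin0 = sin_zero_if_Delta_second_derivative_zero[OF nf(3)]
  have sin: "sin (\<theta> \<sigma>0) = 0" by (rule sin0) (simp only: s0 D23)
  have freq: "\<exists>\<^sub>F x in at s0. sing_order f x \<ge> 4"
    using assms(5) by (simp add: order_ge4_not_isolated_def)
  \<comment> \<open>here and for \<open>\<theta>'\<close> it is used that the point is not isolated among those of order at least 4\<close>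
  have D2': "((\<lambda>x. (pt ^^ 2) D (x, 0)) has_real_derivative 0) (at s0)"
  proof -
    have d: "((\<lambda>x. (pt ^^ 2) D (x, 0)) has_real_derivative ps ((pt ^^ 2) D) (s0, 0)) (at s0)"
      unfolding has_real_derivative_iff_has_vector_derivative
      by (rule has_vector_derivative_ps[OF smooth_on_differentiable[OF smooth_on_funpow_pd[OF smooth_D] s0S]])
    have "\<forall>\<^sub>F x in at s0. sing_order f x \<ge> 4 \<longrightarrow> (pt ^^ 2) D (x, 0) = 0"
      using eventually_axis[OF openS s0S tendsto_ident_at]
      by (rule eventually_mono) (simp add: order4)
    from frequently_mp[OF this freq] have "\<exists>\<^sub>F x in at s0. (pt ^^ 2) D (x, 0) = 0" .
    from derivative_zero_if_zeros_accumulate[OF d D23(1) this] d show ?thesis by simp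
  qed
  have \<theta>': "velocity \<theta> \<sigma>0 = 0"
  proof -
    \<comment> \<open>the points of order at least 4 near \<open>s0\<close> are pulled back along the open map \<open>?\<psi>\<close>\<close>
    let ?\<psi> = "\<lambda>\<sigma>. fst (\<phi> (\<sigma>, 0))"
    have cont: "continuous_on J ?\<psi>"
      by (intro continuous_at_imp_continuous_on ballI continuous_fst has_vector_derivative_continuous
        [OF has_vector_derivative_ps[OF smooth_on_differentiable[OF \<phi>R(1) axis_in_R]]])
    have inj: "inj_on ?\<psi> J"
    proof (rule inj_onI)
      fix x y assume xy: "x \<in> J" "y \<in> J" and "?\<psi> x = ?\<psi> y"
      then have "\<phi> (x, 0) = \<phi> (y, 0)" using nf(6) by (simp add: prod_eq_iff)
      from inj_onD[OF \<phi>R(2) this] xy nf(4) show "x = y" by simp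
    qed
    have "\<exists>\<^sub>F \<sigma> in at \<sigma>0. sin (\<theta> \<sigma>) = 0"
    proof (rule ccontr)
      assume "\<not> (\<exists>\<^sub>F \<sigma> in at \<sigma>0. sin (\<theta> \<sigma>) = 0)"
      then have "\<forall>\<^sub>F \<sigma> in at \<sigma>0. sin (\<theta> \<sigma>) \<noteq> 0" by (simp add: not_frequently)
      then obtain N where N: "open N" "\<sigma>0 \<in> N" "\<And>\<sigma>. \<sigma> \<in> N \<Longrightarrow> \<sigma> \<noteq> \<sigma>0 \<Longrightarrow> sin (\<theta> \<sigma>) \<noteq> 0"
        unfolding eventually_at_topological by blast
      have "open (?\<psi> ` (N \<inter> J))"
        by (rule injective_into_1d_imp_open_map_UNIV[OF _ cont inj]) (use N(1) nf(1) in auto)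
      moreover have "s0 \<in> ?\<psi> ` (N \<inter> J)" using N(2) nf(3) s0 by force
      ultimately have "\<forall>\<^sub>F x in at s0. x \<in> ?\<psi> ` (N \<inter> J)"
        using eventually_at_topological by blast
      then have "\<forall>\<^sub>F x in at s0. x \<in> ?\<psi> ` (N \<inter> J) \<and> x \<noteq> s0"
        by (simp add: eventually_conj_iff eventually_at_filter)
      then have "\<forall>\<^sub>F x in at s0. \<not> sing_order f x \<ge> 4"
      proof (rule eventually_mono)
        fix x assume x: "x \<in> ?\<psi> ` (N \<inter> J) \<and> x \<noteq> s0"
        then obtain \<sigma> where \<sigma>: "\<sigma> \<in> N" "\<sigma> \<in> J" "x = ?\<psi> \<sigma>" "\<sigma> \<noteq> \<sigma>0" using s0 by auto
        show "\<not> sing_order f x \<ge> 4"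
        proof
          assume "sing_order f x \<ge> 4"
          then have "(pt ^^ 2) D (?\<psi> \<sigma>, 0) = 0"
            using order4[OF _ axis_in_S[OF \<sigma>(2)], of 2] \<sigma>(3) by simp
          then have "sin (\<theta> \<sigma>) = 0" by (rule sin_zero_if_Delta_second_derivative_zero[OF \<sigma>(2)])
          then show False using N(3) \<sigma> by blast
        qed
      qed
      with freq show False by (simp add: frequently_def)
    qed
    moreover have "((\<lambda>\<sigma>. sin (\<theta> \<sigma>)) has_real_derivative cos (\<theta> \<sigma>0) * velocity \<theta> \<sigma>0) (at \<sigma>0)"
      by (rule DERIV_fun_sin[OF \<theta>_deriv[OF nf(3)]])
    ultimately have "cos (\<theta> \<sigma>0) * velocity \<theta> \<sigma>0 = 0"
      using derivative_zero_if_zeros_accumulate sin by blast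
    then show ?thesis using sin sin_cos_squared_add[of "\<theta> \<sigma>0"] by auto
  qed
  have "sing_order f s0 > 4 \<longleftrightarrow> enat (Suc 4) \<le> sing_order f s0"
    by (simp only: Suc_ile_eq numeral_eq_enat)
  also have "\<dots> \<longleftrightarrow> (pt ^^ 4) D (s0, 0) = 0"
    unfolding enat_le_sing_order_iff_D[OF s0S] less_Suc_eq using order4[OF assms(4) s0S] by blast
  also have "\<dots> \<longleftrightarrow> cos (\<theta> \<sigma>0) * plane_curvature \<gamma> \<sigma>0 + (\<mu> (\<sigma>0, 0))\<^sup>2 = 0"
    using fourth_derivative[OF nf(3) _ _ _ \<theta>'] D23 D2' s0 by simp
  also have "\<dots> \<longleftrightarrow> concave_type f s0 \<and> \<bar>plane_curvature \<gamma> \<sigma>0\<bar> = (\<mu> (\<sigma>0, 0))\<^sup>2"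
  proof -
    have "cuspidal_edge_point ?S f (\<phi> (\<sigma>0, 0))"
      using assms(1,3) by (simp add: cuspidal_edge_def nf(5))
    from \<mu>_nonzero[OF nf(3) this] have pos: "(\<mu> (\<sigma>0, 0))\<^sup>2 > 0" by simp
    have "(cos (\<theta> \<sigma>0))\<^sup>2 = 1" using sin sin_cos_squared_add[of "\<theta> \<sigma>0"] by simp
    then have "cos (\<theta> \<sigma>0) = 1 \<or> cos (\<theta> \<sigma>0) = -1" by (simp add: power2_eq_1_iff)
    moreover have "concave_type f s0 \<longleftrightarrow> cos (\<theta> \<sigma>0) * plane_curvature \<gamma> \<sigma>0 < 0"
      using concave_type_iff[OF nf(3) sin] by (simp only: s0)
    moreover define m where "m = (\<mu> (\<sigma>0, 0))\<^sup>2"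
    ultimately show ?thesis using pos unfolding m_def[symmetric] by (elim disjE) auto
  qed
  finally show ?thesis .
qed

end
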